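(* Let $q=2^m$ with $m\ge 1$ an integer, and let $\mathcal{L}$ denote the symplectic Lie algebra of $q\times q$ complex matrices. Then there is a decomposition \[ \mathcal{L}=\mathcal{H}_1\perp\cdots\perp\mathcal{H}_{q+1} \] of $\mathcal{L}$ into a direct sum (as vector spaces) of $q+1$ Cartan subalgebras $\mathcal{H}_i$, which are pairwise orthogonal with respect to the Killing form of $\mathcal{L}$, and which are transitively permuted by an automorphism of the Lie algebra $\mathcal{L}$ of order $q+1$ (that is, there is an automorphism of order $q+1$ such that the cyclic group it generates permutes the set $\{\mathcal{H}_1,\dots,\mathcal{H}_{q+1}\}$ transitively).
   Context: For an invertible skew-symmetric $q\times q$ complex matrix $S$, the symplectic Lie algebra consists of all $q\times q$ complex matrices $A$ satisfying $AS+SA^T=0$, with the commutator bracket; up to isomorphism it does not depend on $S$. It has dimension $q(q+1)/2$ and rank $q/2$. The symbol $\perp$ denotes a vector space direct sum whose summands are pairwise orthogonal with respect to the Killing form. *)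

theory Defs
  imports "HOL-Analysis.Analysis" "HOL-Algebra.Bij" "HOL-Algebra.Generated_Groups"
    "HOL-Algebra.Multiplicative_Group"
begin

section \<open>Square complex matrices as a complex vector space\<close>

definition cmat_scale :: "complex \<Rightarrow> complex^'n^'n \<Rightarrow> complex^'n^'n" where
  "cmat_scale c A = (\<chi> i j. c * A $ i $ j)"

interpretation cmat: vector_space "cmat_scale :: complex \<Rightarrow> complex^'n^'n \<Rightarrow> complex^'n^'n"
  by unfold_locales (simp_all add: cmat_scale_def vec_eq_iff algebra_simps)

definition direct_sum_decomp ::
    "'i set \<Rightarrow> ('i \<Rightarrow> (complex^'n^'n) set) \<Rightarrow> (complex^'n^'n) set \<Rightarrow> bool" where
  "direct_sum_decomp I H L \<longleftrightarrow>
     (\<forall>i\<in>I. cmat.subspace (H i)) \<and>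
     L = {\<Sum>i\<in>I. h i | h. \<forall>i\<in>I. h i \<in> H i} \<and>
     (\<forall>h. (\<forall>i\<in>I. h i \<in> H i) \<and> (\<Sum>i\<in>I. h i) = 0 \<longrightarrow> (\<forall>i\<in>I. h i = 0))"

text \<open>The trace of a linear endomorphism \<open>f\<close> of a subspace \<open>V\<close>: the sum of the diagonal
  entries of its matrix with respect to a basis of \<open>V\<close>.  The choice of the basis does not
  matter, see \<open>trace_on_eq\<close>.\<close>

definition trace_on :: "(complex^'n^'n) set \<Rightarrow> (complex^'n^'n \<Rightarrow> complex^'n^'n) \<Rightarrow> complex" where
  "trace_on V f =
     (let B = (SOME B. cmat.independent B \<and> cmat.span B = V)
      in \<Sum>b\<in>B. cmat.representation B (f b) b)"


section \<open>Lie algebras of matrices\<close>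

definition lie_bracket :: "complex^'n^'n \<Rightarrow> complex^'n^'n \<Rightarrow> complex^'n^'n" where
  "lie_bracket A B = A ** B - B ** A"

definition symplectic_lie_algebra :: "complex^'n^'n \<Rightarrow> (complex^'n^'n) set" where
  "symplectic_lie_algebra S = {A. A ** S + S ** transpose A = 0}"

definition lie_subalgebra :: "(complex^'n^'n) set \<Rightarrow> (complex^'n^'n) set \<Rightarrow> bool" where
  "lie_subalgebra L H \<longleftrightarrow>
     H \<subseteq> L \<and> cmat.subspace H \<and> (\<forall>x\<in>H. \<forall>y\<in>H. lie_bracket x y \<in> H)"

fun lower_central :: "(complex^'n^'n) set \<Rightarrow> nat \<Rightarrow> (complex^'n^'n) set" where
  "lower_central H 0 = H"
| "lower_central H (Suc k) = cmat.span {lie_bracket x y | x y. x \<in> H \<and> y \<in> lower_central H k}"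

definition lie_nilpotent :: "(complex^'n^'n) set \<Rightarrow> bool" where
  "lie_nilpotent H \<longleftrightarrow> (\<exists>k. lower_central H k = {0})"

definition lie_normalizer :: "(complex^'n^'n) set \<Rightarrow> (complex^'n^'n) set \<Rightarrow> (complex^'n^'n) set" where
  "lie_normalizer L H = {x \<in> L. \<forall>h\<in>H. lie_bracket x h \<in> H}"

definition cartan_subalgebra :: "(complex^'n^'n) set \<Rightarrow> (complex^'n^'n) set \<Rightarrow> bool" where
  "cartan_subalgebra L H \<longleftrightarrow>
     lie_subalgebra L H \<and> lie_nilpotent H \<and> lie_normalizer L H = H"

definition killing_form ::
    "(complex^'n^'n) set \<Rightarrow> complex^'n^'n \<Rightarrow> complex^'n^'n \<Rightarrow> complex" where
  "killing_form L x y = trace_on L (\<lambda>z. lie_bracket x (lie_bracket y z))"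

definition killing_orthogonal ::
    "(complex^'n^'n) set \<Rightarrow> (complex^'n^'n) set \<Rightarrow> (complex^'n^'n) set \<Rightarrow> bool" where
  "killing_orthogonal L H K \<longleftrightarrow> (\<forall>x\<in>H. \<forall>y\<in>K. killing_form L x y = 0)"

text \<open>As in \<^const>\<open>Bij\<close>, automorphisms are \<^const>\<open>undefined\<close> outside \<open>L\<close>, so
  that two of them are equal iff they agree on \<open>L\<close>.\<close>

definition lie_auto :: "(complex^'n^'n) set \<Rightarrow> (complex^'n^'n \<Rightarrow> complex^'n^'n) set" where
  "lie_auto L = {f \<in> Bij L.
     (\<forall>x\<in>L. \<forall>y\<in>L. f (x + y) = f x + f y) \<and>
     (\<forall>c. \<forall>x\<in>L. f (cmat_scale c x) = cmat_scale c (f x)) \<and>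
     (\<forall>x\<in>L. \<forall>y\<in>L. f (lie_bracket x y) = lie_bracket (f x) (f y))}"

definition LieAutoGroup ::
    "(complex^'n^'n) set \<Rightarrow> (complex^'n^'n \<Rightarrow> complex^'n^'n) monoid" where
  "LieAutoGroup L = BijGroup L \<lparr>carrier := lie_auto L\<rparr>"

definition permutes_transitively :: "('a \<Rightarrow> 'a) set \<Rightarrow> 'a set set \<Rightarrow> bool" where
  "permutes_transitively G \<H> \<longleftrightarrow>
     (\<forall>g\<in>G. bij_betw (image g) \<H> \<H>) \<and> (\<forall>X\<in>\<H>. \<forall>Y\<in>\<H>. \<exists>g\<in>G. g ` X = Y)"


section \<open>Well-definedness\<close>

lemma lie_subalgebra_symplectic:
  fixes S :: "complex^'n^'n"
  shows "lie_subalgebra (symplectic_lie_algebra S) (symplectic_lie_algebra S)"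
proof -
  have sc: "cmat_scale c A ** B = cmat_scale c (A ** B)" "A ** cmat_scale c B = cmat_scale c (A ** B)"
    "transpose (cmat_scale c A) = cmat_scale c (transpose A)" for c and A B :: "complex^'n^'n"
    by (simp_all add: cmat_scale_def matrix_matrix_mult_def transpose_def vec_eq_iff
        sum_distrib_left algebra_simps)
  have ml: "(A - B) ** C = A ** C - B ** C" "C ** (A - B) = C ** A - C ** B"
    "transpose (A - B) = transpose A - transpose B"
    for A B C :: "complex^'n^'n"
    by (simp_all add: matrix_matrix_mult_def transpose_def vec_eq_iff algebra_simps sum_subtractf)
  have "lie_bracket A B ** S + S ** transpose (lie_bracket A B) = 0"
    if "A ** S + S ** transpose A = 0" "B ** S + S ** transpose B = 0" for A B
  proof -
    have a: "S ** transpose A = - (A ** S)" "S ** transpose B = - (B ** S)"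
      using that by (simp_all add: add_eq_0_iff)
    have n: "X ** (- Y) = - (X ** Y)" "(- X) ** Y = - (X ** Y)" for X Y :: "complex^'n^'n"
      by (simp_all add: matrix_matrix_mult_def vec_eq_iff sum_negf)
    have "S ** transpose B ** transpose A = B ** A ** S"
      by (simp add: a n flip: matrix_mul_assoc)
    moreover have "S ** transpose A ** transpose B = A ** B ** S"
      by (simp add: a n flip: matrix_mul_assoc)
    ultimately show ?thesis
      by (simp add: lie_bracket_def ml matrix_transpose_mul matrix_mul_assoc)
  qed
  moreover have "cmat.subspace (symplectic_lie_algebra S)"
  proof -
    have "(A + B) ** S + S ** transpose (A + B) =
        (A ** S + S ** transpose A) + (B ** S + S ** transpose B)" for A B
      by (simp add: matrix_matrix_mult_def transpose_def vec_eq_iff algebra_simps sum.distrib)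
    moreover have "cmat_scale c A ** S + S ** transpose (cmat_scale c A) =
        cmat_scale c (A ** S + S ** transpose A)" for c A
      by (simp add: sc cmat.scale_right_distrib)
    moreover have "(0 :: complex^'n^'n) ** S + S ** transpose 0 = 0"
      by (simp add: matrix_matrix_mult_def transpose_def vec_eq_iff)
    ultimately show ?thesis
      by (auto simp: cmat.subspace_def symplectic_lie_algebra_def)
  qed
  ultimately show ?thesis
    by (auto simp: lie_subalgebra_def symplectic_lie_algebra_def)
qed

lemma group_LieAutoGroup:
  assumes "lie_subalgebra L L"
  shows "group (LieAutoGroup L)"
proof -
  have L: "x + y \<in> L" "cmat_scale c x \<in> L" "lie_bracket x y \<in> L" if "x \<in> L" "y \<in> L" for x y c
    using assms that by (auto simp: lie_subalgebra_def cmat.subspace_def)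
  interpret B: group "BijGroup L" by (rule group_BijGroup)
  have "subgroup (lie_auto L) (BijGroup L)"
  proof (rule B.subgroupI)
    show "lie_auto L \<subseteq> carrier (BijGroup L)"
      by (auto simp: lie_auto_def BijGroup_def)
    have "(\<lambda>x\<in>L. x) \<in> lie_auto L"
      by (auto simp: lie_auto_def id_Bij L)
    then show "lie_auto L \<noteq> {}" by blast
  next
    fix f assume f: "f \<in> lie_auto L"
    then have fB: "f \<in> Bij L" by (simp add: lie_auto_def)
    have un: "restrict (inv_into L f) L (f x) = x" if "x \<in> L" for x
      using fB that by (auto simp: Bij_def bij_betw_def)
    have sur: "\<exists>x'\<in>L. x = f x'" if "x \<in> L" for x
      using fB that by (auto simp: Bij_def bij_betw_def)
    have "restrict (inv_into L f) L \<in> lie_auto L"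
      unfolding lie_auto_def
    proof (intro CollectI conjI ballI allI restrict_inv_into_Bij[OF fB])
      fix x y c assume "x \<in> L" "y \<in> L"
      then obtain x' y' where xy: "x' \<in> L" "y' \<in> L" "x = f x'" "y = f y'"
        using sur by blast
      let ?g = "restrict (inv_into L f) L"
      have "x + y = f (x' + y')" "lie_bracket x y = f (lie_bracket x' y')"
        using f xy by (auto simp: lie_auto_def)
      then show "?g (x + y) = ?g x + ?g y" "?g (lie_bracket x y) = lie_bracket (?g x) (?g y)"
        using L xy un by auto
    next
      fix x c assume "x \<in> L"
      then obtain x' where x: "x' \<in> L" "x = f x'" using sur by blast
      then have "cmat_scale c x = f (cmat_scale c x')" using f by (auto simp: lie_auto_def)
      then show "restrict (inv_into L f) L (cmat_scale c x) =
          cmat_scale c (restrict (inv_into L f) L x)"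
        using L x un by auto
    qed
    then show "inv\<^bsub>BijGroup L\<^esub> f \<in> lie_auto L"
      using fB by (simp add: inv_BijGroup)
  next
    fix f g assume fg: "f \<in> lie_auto L" "g \<in> lie_auto L"
    then have B: "f \<in> Bij L" "g \<in> Bij L" by (auto simp: lie_auto_def)
    have "g x \<in> L" if "x \<in> L" for x using Bij_imp_funcset[OF B(2)] that by auto
    then have "compose L f g \<in> lie_auto L"
      using fg L B compose_Bij[OF B] by (auto simp: lie_auto_def compose_def)
    then show "f \<otimes>\<^bsub>BijGroup L\<^esub> g \<in> lie_auto L"
      using B by (simp add: BijGroup_def)
  qed
  then show ?thesis
    unfolding LieAutoGroup_def by (rule B.subgroup_imp_group)
qed

lemma cmat_independent_finite:
  fixes B :: "(complex^'n^'n) set"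
  assumes "cmat.independent B"
  shows "finite B"
proof -
  let ?E = "\<lambda>(i,j). (\<chi> k l. if k = i \<and> l = j then 1 else 0) :: complex^'n^'n"
  have "A \<in> cmat.span (range ?E)" for A
  proof -
    have "A = (\<Sum>p\<in>UNIV. cmat_scale (A $ fst p $ snd p) (?E p))"
    proof -
      have "(\<Sum>p\<in>UNIV. cmat_scale (A $ fst p $ snd p) (?E p)) $ k $ l = A $ k $ l" for k l
      proof -
        have "(\<Sum>p\<in>UNIV. cmat_scale (A $ fst p $ snd p) (?E p)) $ k $ l =
            (\<Sum>p\<in>UNIV. if p = (k,l) then A $ k $ l else 0)"
          unfolding sum_component by (rule sum.cong) (auto simp: cmat_scale_def split: if_splits)
        then show ?thesis by simp
      qed
      then show ?thesis by (simp add: vec_eq_iff)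
    qed
    also have "\<dots> \<in> cmat.span (range ?E)"
      by (intro cmat.span_sum cmat.span_scale cmat.span_base) auto
    finally show ?thesis .
  qed
  then show ?thesis
    using cmat.independent_span_bound[of "range ?E" B] assms by auto
qed

lemma trace_on_eq:
  fixes B :: "(complex^'n^'n) set"
  assumes B: "cmat.independent B" "cmat.span B = V"
    and f: "\<And>x. x \<in> V \<Longrightarrow> f x \<in> V"
    and add: "\<And>x y. x \<in> V \<Longrightarrow> y \<in> V \<Longrightarrow> f (x + y) = f x + f y"
    and scale: "\<And>c x. x \<in> V \<Longrightarrow> f (cmat_scale c x) = cmat_scale c (f x)"
  shows "trace_on V f = (\<Sum>b\<in>B. cmat.representation B (f b) b)"
proof -
  define C where "C = (SOME B. cmat.independent B \<and> cmat.span B = V)"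
  have C: "cmat.independent C" "cmat.span C = V"
    unfolding C_def using someI[of "\<lambda>B. cmat.independent B \<and> cmat.span B = V" B] B by auto
  have fin: "finite B" "finite C" using B C cmat_independent_finite by auto
  have V: "cmat.subspace V" using B by auto
  have f0: "f 0 = 0" using scale[of 0 0] V by (simp add: cmat.subspace_0)
  have fsum: "f (\<Sum>c\<in>C. cmat_scale (r c) c) = (\<Sum>c\<in>C. cmat_scale (r c) (f c))" for r
  proof -
    have "(\<Sum>c\<in>D. cmat_scale (r c) c) \<in> V \<and>
        f (\<Sum>c\<in>D. cmat_scale (r c) c) = (\<Sum>c\<in>D. cmat_scale (r c) (f c))"
      if "finite D" "D \<subseteq> V" for D
      using that
      by (induction D)
        (auto simp: f0 add scale cmat.subspace_0[OF V] cmat.subspace_add[OF V]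
          cmat.subspace_scale[OF V])
    moreover have "C \<subseteq> V" using C cmat.span_superset by blast
    ultimately show ?thesis using fin by blast
  qed
  have expC: "(\<Sum>c\<in>C. cmat_scale (cmat.representation C v c) c) = v" if "v \<in> V" for v
    using cmat.sum_representation_eq[of C v C] C fin that by auto
  have expB: "(\<Sum>b\<in>B. cmat_scale (cmat.representation B v b) b) = v" if "v \<in> V" for v
    using cmat.sum_representation_eq[of B v B] B fin that by auto
  have inV: "b \<in> V" if "b \<in> B \<union> C" for b
    using that B C cmat.span_superset by blast
  have repB: "cmat.representation B (\<Sum>c\<in>C. cmat_scale (r c) (h c)) b =
      (\<Sum>c\<in>C. r c * cmat.representation B (h c) b)" if "\<And>c. c \<in> C \<Longrightarrow> h c \<in> V" for r h b
    using that B V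
    by (subst cmat.representation_sum)
      (auto simp: cmat.representation_scale cmat.subspace_scale intro!: sum.cong)
  have repC: "cmat.representation C (\<Sum>b\<in>B. cmat_scale (r b) b) c =
      (\<Sum>b\<in>B. r b * cmat.representation C b c)" for r c
    using inV C V
    by (subst cmat.representation_sum)
      (auto simp: cmat.representation_scale cmat.subspace_scale intro!: sum.cong)
  have "(\<Sum>b\<in>B. cmat.representation B (f b) b) =
      (\<Sum>b\<in>B. \<Sum>c\<in>C. cmat.representation C b c *
        (\<Sum>d\<in>C. cmat.representation C (f c) d * cmat.representation B d b))"
  proof (rule sum.cong[OF refl])
    fix b assume "b \<in> B"
    have "cmat.representation B (f b) b =
        cmat.representation B (\<Sum>c\<in>C. cmat_scale (cmat.representation C b c) (f c)) b"
      using fsum[of "cmat.representation C b"] expC[of b] inV[of b] \<open>b \<in> B\<close> by simp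
    also have "\<dots> = (\<Sum>c\<in>C. cmat.representation C b c * cmat.representation B (f c) b)"
      using f inV by (intro repB) auto
    also have "\<dots> = (\<Sum>c\<in>C. cmat.representation C b c *
        (\<Sum>d\<in>C. cmat.representation C (f c) d * cmat.representation B d b))"
    proof (rule sum.cong[OF refl])
      fix c assume "c \<in> C"
      then have "cmat.representation B (f c) b = cmat.representation B
          (\<Sum>d\<in>C. cmat_scale (cmat.representation C (f c) d) d) b"
        using expC[of "f c"] f inV by simp
      also have "\<dots> = (\<Sum>d\<in>C. cmat.representation C (f c) d * cmat.representation B d b)"
        using inV by (intro repB) auto
      finally show "cmat.representation C b c * cmat.representation B (f c) b =
        cmat.representation C b c *
        (\<Sum>d\<in>C. cmat.representation C (f c) d * cmat.representation B d b)" by simp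
    qed
    finally show "cmat.representation B (f b) b = \<dots>" .
  qed
  also have "\<dots> = (\<Sum>c\<in>C. \<Sum>d\<in>C. cmat.representation C (f c) d *
      (\<Sum>b\<in>B. cmat.representation B d b * cmat.representation C b c))"
    by (simp add: sum_distrib_left mult_ac sum.swap[of _ _ B])
  also have "\<dots> = (\<Sum>c\<in>C. \<Sum>d\<in>C. cmat.representation C (f c) d * (if d = c then 1 else 0))"
  proof (intro sum.cong refl)
    fix c d assume "c \<in> C" "d \<in> C"
    have "(\<Sum>b\<in>B. cmat.representation B d b * cmat.representation C b c) =
        cmat.representation C d c"
      using repC[of "cmat.representation B d" c] expB[of d] inV[of d] \<open>d \<in> C\<close> by simp
    then show "cmat.representation C (f c) d *
        (\<Sum>b\<in>B. cmat.representation B d b * cmat.representation C b c) =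
        cmat.representation C (f c) d * (if d = c then 1 else 0)"
      using cmat.representation_basis[OF C(1) \<open>d \<in> C\<close>] by simp
  qed
  also have "\<dots> = (\<Sum>c\<in>C. cmat.representation C (f c) c)"
    using fin by (simp add: if_distrib cong: if_cong)
  finally show ?thesis by (simp add: trace_on_def C_def Let_def)
qed

end

theory Submission
  imports Defs "HOL-Algebra.Algebraic_Closure_Type" "HOL-Library.Z2"
begin

text \<open>
  The Lie algebra is graded by the field \<open>K\<close> with \<open>q\<^sup>2\<close> elements. Let \<open>x \<mapsto> x\<^sup>q\<close> be the
  conjugation of \<open>K\<close> over the subfield \<open>Fq\<close> with \<open>q\<close> elements, \<open>\<psi>\<close> the additive character
  \<open>(-1)\<^bsup>Tr\<^esup>\<close> of \<open>Fq\<close>, and \<open>\<lambda>\<close> an element with \<open>\<lambda>\<^sup>q = \<lambda> + 1\<close>. The bimultiplicative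
  sign \<open>\<chi> x y = \<psi> (\<lambda> x y\<^sup>q + \<lambda>\<^sup>q x\<^sup>q y)\<close> is a cocycle with \<open>\<chi> x x = \<psi> (x\<^bsup>q+1\<^esup>)\<close>, and it is
  exactly invariant, not only up to a coboundary, under multiplication by a primitive root of
  unity \<open>\<omega>\<close> of order \<open>q + 1\<close>. The matrix algebra has a basis \<open>E x\<close>, \<open>x \<in> K\<close>, with
  \<open>E x E y = \<chi> x y E (x + y)\<close> (Pauli matrices with suitable phases), and the involution defined by
  \<open>S\<close> multiplies \<open>E x\<close> by \<open>\<chi> x x\<close>. Hence the symplectic algebra is spanned by the \<open>E x\<close> with
  \<open>\<chi> x x = -1\<close>. Two of the basis elements commute if \<open>x\<close> and \<open>y\<close> lie on the same line
  \<open>\<omega>\<^sup>i Fq\<close>, and each of the \<open>q + 1\<close> lines is its own centralizer: they give the Cartan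
  subalgebras. The invariance of \<open>\<chi>\<close> makes \<open>E x \<mapsto> E (\<omega> x)\<close> an algebra automorphism.
\<close>

section \<open>Finite fields of characteristic two\<close>

text \<open>Over an algebraically closed field \<open>p\<close> splits into linear factors. A factor
  occurring twice would make \<open>pderiv p\<close> vanish at its root as well, so every
  multiplicity is one.\<close>

lemma card_poly_roots_eq_degree:
  fixes p :: "'f::alg_closed_field poly"
  assumes "p \<noteq> 0" and simple: "\<And>x. poly p x = 0 \<Longrightarrow> poly (pderiv p) x \<noteq> 0"
  shows "card {x. poly p x = 0} = Polynomial.degree p"
proof -
  obtain A where A: "size A = Polynomial.degree p" "p = Polynomial.smult (Polynomial.lead_coeff p) (\<Prod>x\<in>#A. [:-x, 1:])"
    using alg_closed_imp_factorization[OF assms(1)] by blast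
  have roots: "{x. poly p x = 0} = set_mset A"
    by (subst A(2)) (use assms(1) in \<open>auto simp: poly_prod_mset prod_mset_zero_iff\<close>)
  have "count A x = 1" if "x \<in># A" for x
  proof -
    have "[:-x, 1:] ^ count A x dvd (\<Prod>x\<in>#A. [:-x, 1:])"
    proof -
      have "(\<Prod>y\<in>#replicate_mset (count A x) x. [:-y, 1:]) dvd (\<Prod>x\<in>#A. [:-x, 1:])"
        by (intro prod_mset_subset_imp_dvd image_mset_subseteq_mono)
           (simp add: count_le_replicate_mset_subset_eq[symmetric])
      then show ?thesis by simp
    qed
    then have "[:-x, 1:] ^ count A x dvd p"
      by (metis A(2) dvd_smult)
    moreover have "\<not> [:-x, 1:] ^ 2 dvd p"
    proof
      assume "[:-x, 1:] ^ 2 dvd p"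
      then obtain r where r: "p = [:-x, 1:] * ([:-x, 1:] * r)"
        unfolding power2_eq_square mult.assoc dvd_def by blast
      have "poly p x = 0" "poly (pderiv p) x = 0"
        unfolding r by (simp_all add: pderiv_mult del: mult_pCons_left)
      with simple show False by blast
    qed
    ultimately have "count A x < 2"
      by (meson dvd_trans le_imp_power_dvd not_le_imp_less)
    moreover have "count A x \<ge> 1" using that by simp
    ultimately show ?thesis by linarith
  qed
  then have "size A = card (set_mset A)"
    by (simp add: size_multiset_overloaded_eq)
  then show ?thesis using A roots by simp
qed

lemma add_self_char_2:
  fixes x :: "'f::ring_1"
  assumes "CHAR('f) = 2"
  shows "x + x = 0"
proof -
  have "of_nat 2 = (0::'f)" using assms of_nat_CHAR[where 'a='f] by simp
  then have "(2::'f) = 0" by simp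
  then show ?thesis by (metis mult_2 mult_zero_left)
qed

lemma add_power_two_power:
  fixes x y :: "'f::comm_semiring_1"
  assumes "CHAR('f) = 2"
  shows "(x + y) ^ (2 ^ k) = x ^ (2 ^ k) + y ^ (2 ^ k)"
  using freshmans_dream'[of "2 ^ k" k x y] assms by simp

text \<open>The polynomial \<open>x ^ (2 ^ k) - x\<close> has derivative \<open>-1\<close> in
  characteristic two, so all its roots are simple.\<close>

lemma card_frobenius_fixed:
  assumes "CHAR('f) = 2" "k > 0"
  shows "card {x::'f::alg_closed_field. x ^ (2 ^ k) = x} = 2 ^ k"
proof -
  define p where "p = Polynomial.monom (1::'f) (2 ^ k) + [:0, -1:]"
  have k1: "(2::nat) ^ k > 1" using assms(2) by (metis one_less_power one_less_numeral_iff semiring_norm(76))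
  have d: "Polynomial.degree p = 2 ^ k"
    unfolding p_def using k1 by (subst Polynomial.degree_add_eq_left) (auto simp: degree_monom_eq)
  have "CHAR('f) dvd 2 ^ k" using assms by simp
  then have "(of_nat (2 ^ k) :: 'f) = 0"
    by (simp only: of_nat_eq_0_iff_char_dvd)
  then have "pderiv p = [:-1:]"
    by (simp add: p_def pderiv_add pderiv_monom pderiv_pCons)
  then have "poly (pderiv p) x \<noteq> 0" for x by simp
  moreover have "p \<noteq> 0" using d k1 by auto
  moreover have "{x. poly p x = 0} = {x. x ^ (2 ^ k) = x}"
    by (auto simp: p_def poly_monom)
  ultimately show ?thesis using card_poly_roots_eq_degree[of p] d by simp
qed

text \<open>The Frobenius-fixed elements form the field with \<open>2 ^ k\<close> elements. They are
  packaged as a ring record so that the library theorem on generators of the multiplicative group of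
  a finite field yields \<open>a\<close>.\<close>

lemma exists_primitive_root_frobenius_fixed:
  assumes "CHAR('f) = 2" "k > 0"
  obtains a :: "'f::alg_closed_field" where "\<And>j. a ^ j = 1 \<longleftrightarrow> (2 ^ k - 1) dvd j"
    "\<And>x. x \<noteq> 0 \<Longrightarrow> x ^ (2 ^ k) = x \<Longrightarrow> \<exists>j. x = a ^ j"
proof -
  define K where "K = {x::'f. x ^ (2 ^ k) = x}"
  define R :: "'f ring" where "R = \<lparr>carrier = K, monoid.mult = (*), one = 1, ring.zero = 0, add = (+)\<rparr>"
  have K: "0 \<in> K" "1 \<in> K" "x \<in> K \<Longrightarrow> y \<in> K \<Longrightarrow> x + y \<in> K" "x \<in> K \<Longrightarrow> y \<in> K \<Longrightarrow> x * y \<in> K"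
    "x \<in> K \<Longrightarrow> inverse x \<in> K" for x y
    using add_power_two_power[OF assms(1)]
    by (auto simp: K_def power_mult_distrib power_0_left power_inverse)
  have card: "card K = 2 ^ k" using card_frobenius_fixed[OF assms] by (simp add: K_def)
  then have fin: "finite K" by (metis card.infinite power_not_zero zero_neq_numeral)
  have "cring R"
  proof (rule cringI)
    show "abelian_group R"
    proof (rule abelian_groupI)
      fix x assume "x \<in> carrier R"
      then show "\<exists>y\<in>carrier R. y \<oplus>\<^bsub>R\<^esub> x = \<zero>\<^bsub>R\<^esub>"
        using add_self_char_2[OF assms(1), of x] by (auto simp: R_def simp del: mult_2 intro!: bexI[of _ x])
    qed (auto simp: R_def K add_ac)
    show "comm_monoid R" by (rule comm_monoidI) (auto simp: R_def K)
  qed (auto simp: R_def algebra_simps)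
  then have "field R"
  proof (rule cring.cring_fieldI2)
    fix a assume "a \<in> carrier R" "a \<noteq> \<zero>\<^bsub>R\<^esub>"
    then show "\<exists>b\<in>carrier R. a \<otimes>\<^bsub>R\<^esub> b = \<one>\<^bsub>R\<^esub>"
      using K by (auto simp: R_def intro!: bexI[of _ "inverse a"])
  qed (auto simp: R_def)
  then interpret R: field R .
  obtain a where a: "a \<in> carrier (Multiplicative_Group.mult_of R)"
      "carrier (Multiplicative_Group.mult_of R) = {a [^]\<^bsub>R\<^esub> i | i::nat. i \<in> UNIV}"
    using R.finite_field_mult_group_has_gen fin by (auto simp: R_def)
  have pow: "b [^]\<^bsub>R\<^esub> (i::nat) = b ^ i" for b i
    by (induction i) (auto simp: R_def nat_pow_def)
  have pow': "b [^]\<^bsub>Multiplicative_Group.mult_of R\<^esub> (i::nat) = b ^ i" for b i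
    by (induction i) (auto simp: R_def nat_pow_def)
  have "group.ord (Multiplicative_Group.mult_of R) a = card (generate (Multiplicative_Group.mult_of R) {a})"
    by (rule group.generate_pow_card[OF R.field_mult_group a(1)])
  also have "generate (Multiplicative_Group.mult_of R) {a} = {a [^]\<^bsub>Multiplicative_Group.mult_of R\<^esub> i | i::nat. i \<in> UNIV}"
    by (rule group.generate_pow_on_finite_carrier[OF R.field_mult_group _ a(1)])
       (use fin in \<open>auto simp: R_def\<close>)
  also have "\<dots> = K - {0}" using a(2) unfolding pow pow' by (simp add: R_def)
  also have "card \<dots> = 2 ^ k - 1" using card fin K by simp
  finally have ord: "group.ord (Multiplicative_Group.mult_of R) a = 2 ^ k - 1" .
  show ?thesis
  proof
    show "a ^ j = 1 \<longleftrightarrow> (2 ^ k - 1) dvd j" for j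
      using group.pow_eq_id[OF R.field_mult_group a(1), of j]
      unfolding ord pow' by (simp add: R_def)
    show "\<exists>j. x = a ^ j" if "x \<noteq> 0" "x ^ (2 ^ k) = x" for x
    proof -
      have "x \<in> carrier (Multiplicative_Group.mult_of R)" using that by (auto simp: R_def K_def)
      then show ?thesis unfolding a(2) pow by blast
    qed
  qed
qed

text \<open>A generator \<open>a\<close> for the field with \<open>q * q\<close> elements has order
  \<open>(q - 1) * (q + 1)\<close>, so \<open>a ^ (q - 1)\<close> generates the elements of norm
  one.\<close>

lemma exists_primitive_unit_root:
  assumes "CHAR('f) = 2" "m > 0"
  obtains w :: "'f::alg_closed_field" where "\<And>j. w ^ j = 1 \<longleftrightarrow> (2 ^ m + 1) dvd j"
    "\<And>x. x ^ (2 ^ m + 1) = 1 \<Longrightarrow> \<exists>j. x = w ^ j"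
proof -
  define q :: nat where "q = 2 ^ m"
  have q: "q > 1" using assms(2) unfolding q_def by (metis one_less_power one_less_numeral_iff semiring_norm(76))
  have e: "(2::nat) ^ (2 * m) - 1 = (q - 1) * (q + 1)"
    by (simp add: q_def power2_eq_square algebra_simps mult_2_right power_add)
  obtain a :: 'f where a: "\<And>j. a ^ j = 1 \<longleftrightarrow> (q - 1) * (q + 1) dvd j"
    "\<And>x. x \<noteq> 0 \<Longrightarrow> x ^ (2 ^ (2 * m)) = x \<Longrightarrow> \<exists>j. x = a ^ j"
    using exists_primitive_root_frobenius_fixed[OF assms(1), of "2 * m"] assms(2) e by auto
  show ?thesis
  proof
    show "(a ^ (q - 1)) ^ j = 1 \<longleftrightarrow> (2 ^ m + 1) dvd j" for j
      using q unfolding power_mult[symmetric] a(1) q_def[symmetric]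
      by (simp only: nat_mult_dvd_cancel1 zero_less_diff)
    fix x :: 'f assume x: "x ^ (2 ^ m + 1) = 1"
    \<comment> \<open>An element with \<open>x ^ (q + 1) = 1\<close> automatically lies in the field
      with \<open>q * q\<close> elements, hence is a power of \<open>a\<close>.\<close>
    have "x ^ (2 ^ (2 * m)) = x ^ (Suc ((q - 1) * (q + 1)))"
      by (metis e Suc_diff_1 pos2 zero_less_power)
    also have "\<dots> = x * (x ^ (q + 1)) ^ (q - 1)"
      by (simp only: power_Suc power_mult mult.commute[of "q - 1"])
    also have "\<dots> = x" using x by (simp add: q_def)
    finally obtain j where j: "x = a ^ j" using a(2)[of x] x by (metis power_0_left zero_neq_one add_is_0 one_neq_zero)
    then have "a ^ (j * (q + 1)) = 1" using x by (simp only: q_def power_mult)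
    then have "(q - 1) * (q + 1) dvd j * (q + 1)" using a(1) by blast
    then have "q - 1 dvd j" by (simp only: dvd_times_right_cancel_iff add_is_0 one_neq_zero simp_thms not_False_eq_True)
    then obtain i where "j = (q - 1) * i" by blast
    then show "\<exists>j. x = (a ^ (q - 1)) ^ j" using j by (auto simp: power_mult)
  qed
qed

text \<open>In characteristic two such a \<open>lam\<close> satisfies
  \<open>lam + lam ^ q = 1\<close>, that is, it has trace one over the field with
  \<open>q = 2 ^ m\<close> elements.\<close>

lemma exists_trace_one:
  assumes "m > 0"
  obtains lam :: "'f::alg_closed_field" where "lam ^ (2 ^ m) = lam + 1"
proof -
  define p where "p = Polynomial.monom (1::'f) (2 ^ m) + [:-1, -1:]"
  have k1: "(2::nat) ^ m > 1" using assms by (metis one_less_power one_less_numeral_iff semiring_norm(76))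
  have "Polynomial.degree p = 2 ^ m"
    unfolding p_def using k1 by (subst Polynomial.degree_add_eq_left) (auto simp: degree_monom_eq)
  then obtain x where "poly p x = 0" using alg_closed_imp_poly_has_root[of p] by auto
  then have "x ^ (2 ^ m) = x + 1" by (simp add: p_def poly_monom algebra_simps)
  then show ?thesis using that by blast
qed

lemma CHAR_bit: "CHAR(bit) = 2"
proof (rule CHAR_eqI)
  have of: "(of_nat x :: bit) = of_bool (odd x)" for x
    by (induction x) auto
  show "2 dvd x" if "(of_nat x :: bit) = 0" for x
    using that unfolding of by (simp split: if_splits)
qed simp

section \<open>A rotation-invariant cocycle\<close>

text \<open>A type cannot depend on \<open>m\<close>, so the fields with \<open>q\<close> and
  \<open>q * q\<close> elements appear as the subsets \<open>Fq\<close> and \<open>K\<close> of one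
  algebraically closed type.\<close>

locale spread_field =
  fixes m :: nat and lam om :: "'f::alg_closed_field"
  assumes char_two: "CHAR('f) = 2" and m_pos: "m > 0"
    and lam: "lam ^ (2 ^ m) = lam + 1"
    and om_power_eq_1: "\<And>j. om ^ j = 1 \<longleftrightarrow> (2 ^ m + 1) dvd j"
    and unit_root_eq_om_power: "\<And>x. x ^ (2 ^ m + 1) = 1 \<Longrightarrow> \<exists>j. x = om ^ j"
begin

definition q :: nat where "q = 2 ^ m"
definition cj :: "'f \<Rightarrow> 'f" where "cj x = x ^ q"
definition Fq :: "'f set" where "Fq = {x. cj x = x}"
definition K :: "'f set" where "K = {x. cj (cj x) = x}"
text \<open>On \<open>Fq\<close> this is the absolute trace to the field with two elements;
  elsewhere it is only an additive polynomial.\<close>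

definition tr :: "'f \<Rightarrow> 'f" where "tr t = (\<Sum>i<m. t ^ (2 ^ i))"
definition psi :: "'f \<Rightarrow> complex" where "psi t = (if tr t = 0 then 1 else -1)"
definition chi :: "'f \<Rightarrow> 'f \<Rightarrow> complex" where "chi x y = psi (lam * x * cj y + cj lam * cj x * y)"
text \<open>The index ranges over all naturals and has period \<open>q + 1\<close>, so
  multiplication by \<open>om\<close> raises it by one without a wrap-around case.\<close>

definition W :: "nat \<Rightarrow> 'f set" where "W i = {om ^ i * t | t. t \<in> Fq}"
definition T :: "'f set" where "T = {x \<in> K. chi x x = -1}"

lemma q_gt_1: "q > 1"
  unfolding q_def using m_pos by (metis one_less_power one_less_numeral_iff semiring_norm(76))

lemma add_self [simp]: "x + x = (0::'f)"
  using add_self_char_2[OF char_two] .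

lemma two_eq_0 [simp]: "(2::'f) = 0"
  using add_self[of 1] by (simp only: one_add_one)

lemma add_eq_0_iff_eq: "x + y = (0::'f) \<longleftrightarrow> x = y"
  by (metis add_self add_left_cancel)

section \<open>Conjugation, norm and trace of \<open>K\<close> over \<open>Fq\<close>\<close>

lemma cj_add: "cj (x + y) = cj x + cj y"
  unfolding cj_def q_def by (rule add_power_two_power[OF char_two])

lemma cj_mult: "cj (x * y) = cj x * cj y"
  by (simp add: cj_def power_mult_distrib)

lemma cj_power: "cj (x ^ k) = cj x ^ k"
  by (simp add: cj_def power_mult[symmetric] mult.commute)

lemma cj_0 [simp]: "cj 0 = 0" and cj_1 [simp]: "cj 1 = 1"
  using q_gt_1 by (auto simp: cj_def power_0_left)

lemma cj_eq_0_iff [simp]: "cj x = 0 \<longleftrightarrow> x = 0"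
  using q_gt_1 by (auto simp: cj_def)

lemma cj_lam: "cj lam = lam + 1"
  using lam by (simp add: cj_def q_def)

lemma lam_in_K: "lam \<in> K"
  by (simp add: K_def cj_lam cj_add add.assoc)

lemma cj_om: "om * cj om = 1"
  using om_power_eq_1[of "q + 1"] by (simp add: cj_def q_def)

lemma om_nonzero [simp]: "om \<noteq> 0"
  using cj_om by auto

lemma om_in_K: "om \<in> K"
proof -
  have "cj om * cj (cj om) = 1" using cj_om by (metis cj_1 cj_mult)
  then show ?thesis using cj_om unfolding K_def
    by (metis (mono_tags, lifting) mem_Collect_eq mult.commute mult_cancel_left mult_zero_left zero_neq_one)
qed

lemma K_closed:
  "0 \<in> K" "1 \<in> K" "x \<in> K \<Longrightarrow> y \<in> K \<Longrightarrow> x + y \<in> K" "x \<in> K \<Longrightarrow> y \<in> K \<Longrightarrow> x * y \<in> K"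
  "x \<in> K \<Longrightarrow> cj x \<in> K" "x \<in> K \<Longrightarrow> x ^ k \<in> K" "x \<in> K \<Longrightarrow> y \<in> K \<Longrightarrow> x / y \<in> K"
  by (auto simp: K_def cj_add cj_mult cj_power) (auto simp: cj_def power_divide)

lemma Fq_closed:
  "0 \<in> Fq" "1 \<in> Fq" "x \<in> Fq \<Longrightarrow> y \<in> Fq \<Longrightarrow> x + y \<in> Fq" "x \<in> Fq \<Longrightarrow> y \<in> Fq \<Longrightarrow> x * y \<in> Fq"
  "x \<in> Fq \<Longrightarrow> x ^ k \<in> Fq" "x \<in> Fq \<Longrightarrow> y \<in> Fq \<Longrightarrow> x / y \<in> Fq"
  by (auto simp: Fq_def cj_add cj_mult cj_power) (auto simp: cj_def power_divide)

lemma Fq_subset_K: "Fq \<subseteq> K"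
  by (auto simp: Fq_def K_def)

lemma norm_in_Fq: "x \<in> K \<Longrightarrow> x * cj x \<in> Fq"
  by (simp add: Fq_def K_def cj_mult mult.commute)

lemma trace_in_Fq: "x \<in> K \<Longrightarrow> x + cj x \<in> Fq"
  by (simp add: Fq_def K_def cj_add add.commute)

lemma card_Fq: "card Fq = q"
  using card_frobenius_fixed[OF char_two m_pos] by (simp add: Fq_def cj_def q_def)

lemma card_K: "card K = q * q"
proof -
  have "q * q = 2 ^ (2 * m)" by (simp add: q_def mult_2 power_add)
  then have "K = {x. x ^ (2 ^ (2 * m)) = x}" by (simp add: K_def cj_def flip: power_mult)
  then show ?thesis
    using card_frobenius_fixed[OF char_two, of "2 * m"] m_pos \<open>q * q = _\<close> by simp
qed

lemma finite_K: "finite K" and finite_Fq: "finite Fq"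
  using card_K card_Fq q_gt_1 card.infinite by fastforce+

lemma Fq_square_inj: "x \<in> Fq \<Longrightarrow> y \<in> Fq \<Longrightarrow> x ^ 2 = y ^ 2 \<Longrightarrow> x = y"
proof -
  assume "x ^ 2 = y ^ 2"
  then have "(x + y) ^ 2 = 0"
    using add_power_two_power[OF char_two, of x y 1] by simp
  then show "x = y" by (simp add: add_eq_0_iff_eq)
qed

text \<open>Since \<open>x ^ q = x\<close> and \<open>q\<close> is even, the power of
  \<open>x\<close> with exponent \<open>q / 2\<close> is a square root.\<close>

lemma Fq_square_root: "x \<in> Fq \<Longrightarrow> \<exists>y\<in>Fq. y ^ 2 = x"
proof -
  assume x: "x \<in> Fq"
  have "q = (2 ^ (m - 1)) * 2" using m_pos by (simp add: q_def flip: power_Suc2)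
  then have "(x ^ (2 ^ (m - 1))) ^ 2 = x"
    using x by (simp add: Fq_def cj_def flip: power_mult)
  then show ?thesis using Fq_closed(5)[OF x] by blast
qed

section \<open>The absolute trace and the additive character \<open>psi\<close>\<close>

lemma tr_add: "tr (x + y) = tr x + tr y"
  by (simp add: tr_def add_power_two_power[OF char_two] sum.distrib)

text \<open>Squaring shifts the exponents \<open>2 ^ i\<close> by one place, so the two sums differ
  only in the end terms \<open>x\<close> and \<open>x ^ q\<close>.\<close>

lemma tr_square: "tr (x ^ 2) = tr x + x + cj x"
proof -
  have "x + tr (x ^ 2) = tr x + cj x"
    using sum.lessThan_Suc_shift[of "\<lambda>i. x ^ (2 ^ i)" m]
    by (simp add: tr_def cj_def q_def power_mult[symmetric])
  then have "(x + x) + tr (x ^ 2) = x + (tr x + cj x)" by (simp only: add.assoc)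
  then show ?thesis by (simp add: add_ac)
qed

lemma tr_power2: "tr x ^ 2 = tr (x ^ 2)"
proof -
  have "sum f {..<k} ^ 2 = (\<Sum>i<k. f i ^ 2)" for f :: "nat \<Rightarrow> 'f" and k
    using add_power_two_power[OF char_two, of _ _ 1] by (induction k) auto
  then show ?thesis by (simp add: tr_def mult.commute flip: power_mult)
qed

lemma tr_Fq_cases: "x \<in> Fq \<Longrightarrow> tr x = 0 \<or> tr x = 1"
proof -
  assume "x \<in> Fq"
  then have "tr x ^ 2 = tr x" by (simp add: tr_power2 tr_square Fq_def add.assoc)
  then show ?thesis by (simp add: power2_eq_square)
qed

lemma psi_0 [simp]: "psi 0 = 1"
  by (simp add: psi_def tr_def power_0_left)

lemma psi_cases: "psi x = 1 \<or> psi x = -1"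
  by (simp add: psi_def)

lemma psi_psi [simp]: "psi x * psi x = 1"
  by (simp add: psi_def)

lemma psi_add: "x \<in> Fq \<Longrightarrow> y \<in> Fq \<Longrightarrow> psi (x + y) = psi x * psi y"
  using tr_Fq_cases[of x] tr_Fq_cases[of y] by (auto simp: psi_def tr_add)

lemma psi_square: "x \<in> Fq \<Longrightarrow> psi (x ^ 2) = psi x"
  by (simp add: psi_def tr_square Fq_def add.assoc)

text \<open>As a polynomial, \<open>tr\<close> has linear coefficient one and degree at most
  \<open>2 ^ (m - 1)\<close>, which is too small for it to vanish at all \<open>q\<close> elements
  of \<open>Fq\<close>.\<close>

lemma psi_nontrivial: "\<exists>t\<in>Fq. psi t = -1"
proof (rule ccontr)
  assume "\<not> ?thesis"
  then have zero: "tr t = 0" if "t \<in> Fq" for t using that by (metis psi_def)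
  define p where "p = (\<Sum>i<m. Polynomial.monom (1::'f) (2 ^ i))"
  have "poly p t = tr t" for t by (simp add: p_def tr_def poly_sum poly_monom)
  then have sub: "Fq \<subseteq> {t. poly p t = 0}" using zero by auto
  have "Polynomial.coeff p 1 = (\<Sum>i<m. if i = 0 then 1 else 0)"
    unfolding p_def coeff_sum coeff_monom by (intro sum.cong) auto
  then have "Polynomial.coeff p 1 = 1" using m_pos by simp
  then have p0: "p \<noteq> 0" by auto
  have "Polynomial.degree p \<le> 2 ^ (m - 1)"
    unfolding p_def by (intro degree_sum_le) (auto intro!: order.trans[OF degree_monom_le])
  then have "card {t. poly p t = 0} \<le> 2 ^ (m - 1)"
    using card_poly_roots_bound[OF p0] by simp
  then have "q \<le> 2 ^ (m - 1)"
    using card_mono[OF poly_roots_finite[OF p0] sub] by (simp add: card_Fq)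
  moreover have "(2::nat) ^ (m - 1) < q" unfolding q_def using m_pos by (intro power_strict_increasing) auto
  ultimately show False by simp
qed

lemma psi_nondegenerate:
  assumes "c \<in> Fq" "\<And>t. t \<in> Fq \<Longrightarrow> psi (c * t) = 1"
  shows "c = 0"
proof (rule ccontr)
  assume "c \<noteq> 0"
  obtain t where t: "t \<in> Fq" "psi t = -1" using psi_nontrivial by blast
  then have "psi (c * (t / c)) = 1" by (intro assms(2) Fq_closed(6) assms(1) t(1))
  then show False using t \<open>c \<noteq> 0\<close> by simp
qed

text \<open>In \<open>tr (lam ^ 2 + lam)\<close> everything cancels except
  \<open>lam + cj lam = 1\<close>. This sign later makes the constructed matrix \<open>S\<close>
  skew-symmetric.\<close>

lemma psi_norm_lam: "psi (lam * cj lam) = -1"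
proof -
  have "lam * cj lam = lam ^ 2 + lam"
    unfolding cj_lam power2_eq_square distrib_left by (simp only: mult_1_right)
  then have "tr (lam * cj lam) = (tr lam + lam + cj lam) + tr lam"
    by (simp only: tr_add tr_square)
  also have "\<dots> = (tr lam + tr lam) + (lam + cj lam)" by (simp only: add_ac)
  also have "\<dots> = lam + cj lam" by (simp only: add_self add_0_left)
  finally have "tr (lam * cj lam) = lam + cj lam" .
  moreover have "lam + cj lam = 1"
    unfolding cj_lam by (simp only: add.assoc[symmetric] add_self add_0_left)
  ultimately have "tr (lam * cj lam) = 1" by (rule trans)
  then show ?thesis by (simp add: psi_def)
qed

section \<open>The sign cocycle \<open>chi\<close> and its commutation form\<close>

lemma chi_arg_in_Fq:
  assumes "x \<in> K" "y \<in> K"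
  shows "lam * x * cj y + cj lam * cj x * y \<in> Fq"
  \<comment> \<open>The two summands are conjugate to each other, so \<open>cj\<close> merely
    exchanges them.\<close>
  using assms lam_in_K by (simp add: Fq_def K_def cj_add cj_mult add.commute)

lemma chi_cases: "chi x y = 1 \<or> chi x y = -1"
  by (simp add: chi_def psi_cases)

lemma chi_chi [simp]: "chi x y * chi x y = 1"
  by (simp add: chi_def)

lemma chi_nonzero [simp]: "chi x y \<noteq> 0"
  using chi_cases[of x y] by auto

lemma chi_0 [simp]: "chi 0 x = 1" "chi x 0 = 1"
  by (simp_all add: chi_def)

lemma chi_add_left:
  assumes "x \<in> K" "y \<in> K" "z \<in> K"
  shows "chi (x + y) z = chi x z * chi y z"
proof -
  have "lam * (x + y) * cj z + cj lam * cj (x + y) * z =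
     (lam * x * cj z + cj lam * cj x * z) + (lam * y * cj z + cj lam * cj y * z)"
    by (simp add: cj_add algebra_simps)
  then show ?thesis unfolding chi_def by (simp add: psi_add chi_arg_in_Fq assms)
qed

lemma chi_add_right:
  assumes "x \<in> K" "y \<in> K" "z \<in> K"
  shows "chi x (y + z) = chi x y * chi x z"
proof -
  have "lam * x * cj (y + z) + cj lam * cj x * (y + z) =
     (lam * x * cj y + cj lam * cj x * y) + (lam * x * cj z + cj lam * cj x * z)"
    by (simp add: cj_add algebra_simps)
  then show ?thesis unfolding chi_def by (simp add: psi_add chi_arg_in_Fq assms)
qed

text \<open>Both summands of the argument are multiplied by the norm \<open>om * cj om\<close>,
  which is one.\<close>

lemma chi_om: "chi (om * x) (om * y) = chi x y"
proof -
  have "lam * (om * x) * cj (om * y) = (om * cj om) * (lam * x * cj y)"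
    "cj lam * cj (om * x) * (om * y) = (om * cj om) * (cj lam * cj x * y)"
    by (simp_all add: cj_mult mult_ac)
  then show ?thesis unfolding chi_def by (simp only: cj_om mult_1)
qed

lemma chi_diag: "chi x x = psi (x * cj x)"
proof -
  have "lam * x * cj x + cj lam * cj x * x = (lam + lam) * x * cj x + x * cj x"
    by (simp add: cj_lam algebra_simps)
  then show ?thesis by (simp add: chi_def)
qed

text \<open>After substituting \<open>cj lam = lam + 1\<close>, every term containing
  \<open>lam\<close> occurs twice and cancels. What remains is the trace form of \<open>K\<close>
  over \<open>Fq\<close>, which decides whether two basis elements commute or anticommute.\<close>

lemma chi_chi_swap:
  assumes "x \<in> K" "y \<in> K"
  shows "chi x y * chi y x = psi (x * cj y + cj x * y)"
proof -
  have "(lam * x * cj y + cj lam * cj x * y) + (lam * y * cj x + cj lam * cj y * x) =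
    (lam * x * cj y + lam * x * cj y) + (lam * cj x * y + lam * cj x * y) + (x * cj y + cj x * y)"
    by (simp only: cj_lam) (simp only: algebra_simps mult_1)
  also have "\<dots> = x * cj y + cj x * y" by (simp only: add_self add_0_left)
  finally show ?thesis unfolding chi_def
    by (simp only: psi_add[OF chi_arg_in_Fq chi_arg_in_Fq, OF assms assms(2,1), symmetric])
qed

lemma chi_commute_iff:
  assumes "x \<in> K" "y \<in> K"
  shows "chi x y = chi y x \<longleftrightarrow> psi (x * cj y + cj x * y) = 1"
  unfolding chi_chi_swap[OF assms, symmetric]
  using chi_cases[of x y] chi_cases[of y x] by auto

lemma chi_nondegenerate:
  assumes "x \<in> K" "\<And>y. y \<in> K \<Longrightarrow> chi x y = chi y x"
  shows "x = 0"
proof (rule ccontr)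
  assume x: "x \<noteq> 0"
  obtain c where c: "c \<in> Fq" "psi c = -1" using psi_nontrivial by blast
  \<comment> \<open>This makes \<open>cj x * y = lam * c\<close>, whose trace over \<open>Fq\<close>
    is \<open>c\<close> because \<open>lam\<close> has trace one.\<close>
  define y where "y = lam * c / cj x"
  have y: "y \<in> K" unfolding y_def
    using c Fq_subset_K by (intro K_closed(4,5,7) lam_in_K assms(1)) auto
  have "cj y = cj lam * c / x"
    using assms(1) c by (simp add: y_def cj_def power_divide power_mult_distrib K_def Fq_def)
  then have "x * cj y + cj x * y = cj lam * c + lam * c" using x by (simp add: y_def)
  also have "\<dots> = (lam * c + lam * c) + c" by (simp only: cj_lam) (simp only: algebra_simps mult_1)
  finally have "x * cj y + cj x * y = c" by simp
  then show False using assms(2)[OF y] chi_commute_iff[OF assms(1) y] c by simp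
qed

section \<open>The lines \<open>W i\<close> and their intersections with \<open>T\<close>\<close>

lemma cj_om_power: "om ^ i * cj (om ^ i) = 1"
  by (simp add: cj_power cj_om flip: power_mult_distrib)

lemma W_subset_K: "W i \<subseteq> K"
  using om_in_K K_closed Fq_subset_K by (auto simp: W_def)

lemma W_add: "x \<in> W i \<Longrightarrow> y \<in> W i \<Longrightarrow> x + y \<in> W i"
  unfolding W_def using Fq_closed(3) by (fastforce simp flip: distrib_left)

text \<open>As \<open>om ^ i\<close> has norm one, both terms of the trace form reduce to the same
  product \<open>s * t\<close> and cancel.\<close>

lemma chi_commute_W:
  assumes "x \<in> W i" "y \<in> W i"
  shows "chi x y = chi y x"
proof -
  obtain s t where st: "s \<in> Fq" "t \<in> Fq" "x = om ^ i * s" "y = om ^ i * t"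
    using assms by (auto simp: W_def)
  have "x * cj y = (om ^ i * cj (om ^ i)) * (s * t)" "cj x * y = (om ^ i * cj (om ^ i)) * (s * t)"
    using st by (simp_all add: cj_mult Fq_def mult_ac)
  then show ?thesis using assms W_subset_K
    by (subst chi_commute_iff) (auto simp: cj_om_power)
qed

text \<open>With \<open>w = om ^ i\<close> and \<open>z = x * cj w\<close>, commuting with
  \<open>w * t\<close> means \<open>psi ((z + cj z) * t) = 1\<close>. For all \<open>t\<close> in
  \<open>Fq\<close> this forces \<open>z\<close> into \<open>Fq\<close>, and
  \<open>x = w * z\<close>.\<close>

lemma W_maximal:
  assumes "x \<in> K" "\<And>h. h \<in> W i \<Longrightarrow> chi x h = chi h x"
  shows "x \<in> W i"
proof -
  define w where "w = om ^ i"
  have w: "w \<in> K" "w * cj w = 1"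
    using cj_om_power K_closed(6)[OF om_in_K] by (simp_all add: w_def)
  define z where "z = x * cj w"
  have z: "z \<in> K" unfolding z_def by (intro K_closed(4,5) assms w)
  have "psi ((z + cj z) * t) = 1" if t: "t \<in> Fq" for t
  proof -
    have wt: "w * t \<in> W i" using t by (auto simp: W_def w_def)
    have "x * cj (w * t) + cj x * (w * t) = (z + cj z) * t"
      using w(1) t by (simp add: z_def cj_mult K_def Fq_def algebra_simps)
    moreover have "psi (x * cj (w * t) + cj x * (w * t)) = 1"
      using assms(2)[OF wt] chi_commute_iff[of x "w * t"] assms(1) W_subset_K wt by blast
    ultimately show ?thesis by simp
  qed
  then have "z + cj z = 0" by (rule psi_nondegenerate[OF trace_in_Fq[OF z]])
  then have "z \<in> Fq" by (simp add: add_eq_0_iff_eq Fq_def)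
  moreover have "x = w * z"
    unfolding z_def by (simp only: mult.left_commute[of w] w(2) mult_1_right)
  ultimately show ?thesis by (auto simp: W_def w_def)
qed

lemma norm_W: "t \<in> Fq \<Longrightarrow> (om ^ i * t) * cj (om ^ i * t) = t ^ 2"
proof -
  assume "t \<in> Fq"
  then have "(om ^ i * t) * cj (om ^ i * t) = (om ^ i * cj (om ^ i)) * t ^ 2"
    by (simp add: cj_mult Fq_def power2_eq_square mult_ac)
  then show ?thesis by (simp only: cj_om_power mult_1)
qed

text \<open>On a line the diagonal sign of \<open>om ^ i * t\<close> is
  \<open>psi (t ^ 2) = psi t\<close>, which takes the value \<open>-1\<close>.\<close>

lemma W_Int_T_nonempty: "\<exists>h. h \<in> W i \<inter> T"
proof -
  obtain t where t: "t \<in> Fq" "psi t = -1" using psi_nontrivial by blast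
  have "om ^ i * t \<in> W i" using t by (auto simp: W_def)
  moreover have "chi (om ^ i * t) (om ^ i * t) = -1"
    using t by (simp add: chi_diag norm_W psi_square)
  ultimately show ?thesis using W_subset_K by (auto simp: T_def)
qed

text \<open>The two mixed factors are equal on a line, so their product is one and the diagonal sign
  becomes a character there.\<close>

lemma chi_diag_add_W:
  assumes "x \<in> W i" "y \<in> W i"
  shows "chi (x + y) (x + y) = chi x x * chi y y"
proof -
  have "x \<in> K" "y \<in> K" using assms W_subset_K by auto
  then have "chi (x + y) (x + y) = chi x x * chi y y * (chi x y * chi y x)"
    by (simp add: chi_add_left chi_add_right K_closed)
  then show ?thesis by (simp add: chi_commute_W[OF assms])
qed

text \<open>Commuting with \<open>W i \<inter> T\<close> already forces commuting with the whole
  line: for \<open>w\<close> outside \<open>T\<close> and \<open>h\<close> in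
  \<open>W i \<inter> T\<close>, the sum \<open>w + h\<close> lies in \<open>T\<close>
  again.\<close>

lemma W_Int_T_maximal:
  assumes "x \<in> K" "\<And>h. h \<in> W i \<inter> T \<Longrightarrow> chi x h = chi h x"
  shows "x \<in> W i"
proof (rule W_maximal[OF assms(1)])
  fix w assume w: "w \<in> W i"
  show "chi x w = chi w x"
  proof (cases "w \<in> T")
    case False
    obtain h where h: "h \<in> W i" "h \<in> T" using W_Int_T_nonempty by blast
    have K: "w \<in> K" "h \<in> K" using w h W_subset_K by auto
    have "chi w w = 1" using False K chi_cases by (auto simp: T_def)
    then have "w + h \<in> W i \<inter> T"
      using h w K W_add[OF w h(1)] by (simp add: T_def chi_diag_add_W K_closed(3))
    then have "chi x (w + h) = chi (w + h) x" "chi x h = chi h x" using assms(2) h by auto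
    then show ?thesis using K assms(1) by (simp add: chi_add_left chi_add_right)
  qed (use assms(2) w in blast)
qed

lemma om_power_mod: "om ^ i = om ^ (i mod (q + 1))"
proof -
  have "om ^ i = om ^ (i mod (q + 1)) * (om ^ (q + 1)) ^ (i div (q + 1))"
    by (simp only: power_mult[symmetric] power_add[symmetric] mod_mult_div_eq)
  then show ?thesis using om_power_eq_1[of "q + 1"] by (simp add: q_def)
qed

lemma W_mod: "W i = W (i mod (q + 1))"
  using om_power_mod[of i] unfolding W_def by simp

text \<open>A polar decomposition: with \<open>t\<close> the square root of the norm of
  \<open>x\<close>, the quotient \<open>x / t\<close> has norm one and is therefore a power of
  \<open>om\<close>.\<close>

lemma W_cover:
  assumes "x \<in> K"
  shows "\<exists>i\<in>{1..q + 1}. x \<in> W i"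
proof (cases "x = 0")
  case True
  then show ?thesis using Fq_closed(1) by (intro bexI[of _ 1]) (auto simp: W_def)
next
  case False
  obtain t where t: "t \<in> Fq" "t ^ 2 = x * cj x" using Fq_square_root norm_in_Fq[OF assms] by blast
  have t0: "t \<noteq> 0" using t False by auto
  have "(x / t) ^ (q + 1) = (x * cj x) / (t * cj t)" by (simp add: cj_def power_divide)
  also have "\<dots> = 1" using t t0 False by (simp add: Fq_def power2_eq_square)
  finally obtain j where j: "x / t = om ^ j" using unit_root_eq_om_power unfolding q_def by blast
  then have "x = om ^ j * t" using t0 by (simp add: divide_eq_eq)
  then have xj: "x \<in> W j" using t(1) unfolding W_def by blast
  show ?thesis
  \<comment> \<open>The index range starts at one, so the residue zero is represented by
    \<open>q + 1\<close>.\<close>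
  proof (cases "j mod (q + 1) = 0")
    case True
    then have "x \<in> W (q + 1)" using xj W_mod[of j] W_mod[of "q + 1"] by simp
    then show ?thesis by auto
  next
    case False
    then have "j mod (q + 1) \<in> {1..q + 1}" by (simp add: Suc_le_eq less_imp_le)
    then show ?thesis using xj W_mod[of j] by blast
  qed
qed

text \<open>The norm of \<open>x\<close> is the square of its coordinate on the line. Square roots
  in \<open>Fq\<close> are unique, so \<open>x\<close> determines the coordinate and with it the
  power of \<open>om\<close>.\<close>

lemma W_disjoint:
  assumes "x \<in> W i" "x \<in> W j" "x \<noteq> 0" "i \<in> {1..q + 1}" "j \<in> {1..q + 1}"
  shows "i = j"
proof -
  have aux: "i = j" if ij: "i \<le> j" "i \<in> {1..q + 1}" "j \<in> {1..q + 1}" "om ^ i = om ^ j" for i j :: nat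
  proof -
    have "om ^ i * om ^ (j - i) = om ^ j"
      unfolding power_add[symmetric] le_add_diff_inverse[OF ij(1)] ..
    then have "om ^ i * om ^ (j - i) = om ^ i * 1" unfolding ij(4) by (simp only: mult_1_right)
    then have "om ^ (j - i) = 1" using mult_left_cancel[of "om ^ i"] by force
    then have "q + 1 dvd j - i" using om_power_eq_1 by (simp add: q_def)
    then show ?thesis using ij by (auto dest!: dvd_imp_le)
  qed
  obtain s t where st: "s \<in> Fq" "t \<in> Fq" "x = om ^ i * s" "x = om ^ j * t"
    using assms by (auto simp: W_def)
  then have "s ^ 2 = t ^ 2" using norm_W[OF st(1), of i] norm_W[OF st(2), of j] by simp
  then have "s = t" using st Fq_square_inj by blast
  then have om: "om ^ i = om ^ j" using st(3,4) assms(3) by (metis mult_eq_0_iff mult_right_cancel)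
  show ?thesis
  proof (cases "i \<le> j")
    case True
    then show ?thesis by (rule aux[OF _ assms(4,5) om])
  next
    case False
    then show ?thesis using aux[OF _ assms(5,4) om[symmetric]] by simp
  qed
qed

lemma om_mult_T: "om * x \<in> T \<longleftrightarrow> x \<in> T"
proof -
  have "om * x / om = x" by simp
  then have "om * x \<in> K \<longleftrightarrow> x \<in> K"
    using K_closed(4)[OF om_in_K] K_closed(7)[OF _ om_in_K] by metis
  then show ?thesis by (simp add: T_def chi_om)
qed

lemma om_mult_W: "om * x \<in> W (Suc i) \<longleftrightarrow> x \<in> W i"
proof -
  have "om * x = om * y \<longleftrightarrow> x = y" for y by simp
  then show ?thesis unfolding W_def power_Suc mult.assoc by simp
qed

end

section \<open>Phased Pauli matrices\<close>

text \<open>A symmetric bimultiplicative sign becomes a coboundary once fourth roots of unity are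
  allowed as values. A subgroup \<open>U\<close> of largest size carrying such an \<open>f\<close>
  must be all of \<open>V\<close>, since otherwise \<open>f\<close> extends across one further
  generator \<open>u\<close>.\<close>

lemma exists_quadratic_refinement:
  fixes V :: "'a::ab_group_add set" and beta :: "'a \<Rightarrow> 'a \<Rightarrow> complex"
  assumes exp2: "\<And>x::'a. x + x = 0"
    and V: "finite V" "0 \<in> V" "\<And>x y. x \<in> V \<Longrightarrow> y \<in> V \<Longrightarrow> x + y \<in> V"
    and sq: "\<And>x y. beta x y * beta x y = 1"
    and sym: "\<And>x y. x \<in> V \<Longrightarrow> y \<in> V \<Longrightarrow> beta x y = beta y x"
    and add: "\<And>x y z. x \<in> V \<Longrightarrow> y \<in> V \<Longrightarrow> z \<in> V \<Longrightarrow> beta x (y + z) = beta x y * beta x z"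
  shows "\<exists>f. f 0 = 1 \<and> (\<forall>x\<in>V. \<forall>y\<in>V. f x * f y = beta x y * f (x + y))"
proof -
  define good where "good U \<longleftrightarrow> U \<subseteq> V \<and> 0 \<in> U \<and> (\<forall>x\<in>U. \<forall>y\<in>U. x + y \<in> U) \<and>
    (\<exists>f. f 0 = 1 \<and> (\<forall>x\<in>U. \<forall>y\<in>U. f x * f y = beta x y * f (x + y)))" for U
  have beta0: "beta x 0 = 1" if "x \<in> V" for x
    using add[OF that V(2,2)] sq[of x 0] by simp
  have "good {0}"
    unfolding good_def using V beta0 by (auto intro!: exI[of _ "\<lambda>_. 1"])
  moreover have "finite {U. good U}"
    by (rule finite_subset[of _ "Pow V"]) (auto simp: good_def V)
  ultimately have fin: "finite (card ` {U. good U})" "card ` {U. good U} \<noteq> {}" by auto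
  then have "Max (card ` {U. good U}) \<in> card ` {U. good U}" by (rule Max_in)
  then obtain U where U: "good U" "card U = Max (card ` {U. good U})" by auto
  have max: "card U' \<le> card U" if "good U'" for U'
    unfolding U(2) using that fin by (intro Max_ge) auto
  obtain f where f: "f 0 = 1" "\<And>x y. x \<in> U \<Longrightarrow> y \<in> U \<Longrightarrow> f x * f y = beta x y * f (x + y)"
    using U(1) by (auto simp: good_def)
  have UV: "U \<subseteq> V" "0 \<in> U" "\<And>x y. x \<in> U \<Longrightarrow> y \<in> U \<Longrightarrow> x + y \<in> U"
    using U(1) by (auto simp: good_def)
  have "U = V"
  proof (rule ccontr)
    assume "U \<noteq> V"
    then obtain u where u: "u \<in> V" "u \<notin> U" using UV by blast
    have uu: "u + (u + v) = v" for v using exp2[of u] by (metis add.assoc add_0_left)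
    have notin: "u + v \<notin> U" if "v \<in> U" for v
    proof
      assume "u + v \<in> U"
      then have "u + v + v \<in> U" using that UV by blast
      then show False using u exp2[of v] by (simp add: add.assoc)
    qed
    \<comment> \<open>The value at the new generator \<open>u\<close> is a square root of \<open>beta u u\<close>, as forced by \<open>y = x\<close>.\<close>
    define z where "z = csqrt (beta u u)"
    have z: "z * z = beta u u" by (metis z_def power2_csqrt power2_eq_square)
    \<comment> \<open>An argument \<open>x\<close> in the new coset is \<open>u + v\<close> with
      \<open>v = u + x\<close>, because \<open>u + u = 0\<close>.\<close>
    define g where "g x = (if x \<in> U then f x else z * beta u (u + x) * f (u + x))" for x
    have g1: "g v = f v" if "v \<in> U" for v using that by (simp add: g_def)
    have g2: "g (u + v) = z * beta u v * f v" if "v \<in> U" for v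
      using notin[OF that] by (simp add: g_def uu)
    define U' where "U' = U \<union> (+) u ` U"
    have b: "beta u v * beta v u = 1" if "v \<in> V" for v using sym[OF u(1) that] sq by simp
    have mixed: "g x * g (u + v) = beta x (u + v) * g (x + (u + v))"
      if "x \<in> U" "v \<in> U" for x v
    proof -
      have K: "x \<in> V" "v \<in> V" "u \<in> V" using that UV u by auto
      have "g x * g (u + v) = z * beta u v * (f x * f v)" using that by (simp add: g1 g2)
      also have "\<dots> = z * beta u v * beta x v * f (x + v) * (beta u x * beta x u)"
        using that b[OF K(1)] by (simp add: f)
      also have "\<dots> = beta x (u + v) * (z * beta u (x + v) * f (x + v))"
        by (simp add: add K)
      also have "z * beta u (x + v) * f (x + v) = g (u + (x + v))" using that UV by (simp add: g2)
      finally show ?thesis by (simp add: add.left_commute)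
    qed
    have both: "g (u + v) * g (u + w) = beta (u + v) (u + w) * g (u + v + (u + w))"
      if "v \<in> U" "w \<in> U" for v w
    proof -
      have K: "v \<in> V" "w \<in> V" "u \<in> V" "u + w \<in> V" "u + v \<in> V" using that UV u V by auto
      have "beta (u + v) (u + w) = beta (u + w) u * beta (u + w) v"
        using sym[OF K(5,4)] add[OF K(4,3,1)] by simp
      also have "\<dots> = beta u u * beta u w * (beta v u * beta v w)"
        using sym[OF K(4,3)] sym[OF K(4,1)] by (simp add: add K)
      also have "\<dots> = z * z * beta u v * beta u w * beta v w"
        using sym[OF K(1,3)] by (simp add: z)
      finally have *: "beta (u + v) (u + w) = z * z * beta u v * beta u w * beta v w" .
      have "u + v + (u + w) = v + w" using uu[of "v + w"] by (simp add: ac_simps)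
      then have "g (u + v + (u + w)) = f (v + w)" by (simp only: g1[OF UV(3)[OF that]])
      moreover have "g (u + v) * g (u + w) = z * z * beta u v * beta u w * (f v * f w)"
        using that by (simp add: g2)
      ultimately show ?thesis using that by (simp add: * f)
    qed
    have "U' \<subseteq> V" "0 \<in> U'" using UV u V by (auto simp: U'_def)
    moreover have "x + y \<in> U'" if xy: "x \<in> U'" "y \<in> U'" for x y
    proof -
      have mem: "a \<in> U' \<longleftrightarrow> a \<in> U \<or> u + a \<in> U" for a
        unfolding U'_def by (auto simp: uu) (metis imageI uu)
      consider "x \<in> U" "y \<in> U" | "x \<in> U" "u + y \<in> U" | "u + x \<in> U" "y \<in> U"
        | "u + x \<in> U" "u + y \<in> U"
        using xy unfolding mem by blast
      then show ?thesis
      proof cases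
        case 1 then show ?thesis unfolding mem using UV(3) by blast
      next
        case 2
        then have "x + (u + y) \<in> U" by (rule UV(3))
        then show ?thesis unfolding mem by (simp only: add.left_commute simp_thms)
      next
        case 3
        then have "(u + x) + y \<in> U" by (rule UV(3))
        then show ?thesis unfolding mem by (simp only: add.assoc simp_thms)
      next
        case 4
        then have "(u + x) + (u + y) \<in> U" by (rule UV(3))
        moreover have "(u + x) + (u + y) = u + (u + (x + y))" by (simp only: ac_simps)
        ultimately show ?thesis unfolding mem by (simp only: uu simp_thms)
      qed
    qed
    moreover have "g x * g y = beta x y * g (x + y)" if xy: "x \<in> U'" "y \<in> U'" for x y
    proof -
      have K: "x \<in> V" "y \<in> V" using xy \<open>U' \<subseteq> V\<close> by auto
      consider "x \<in> U" "y \<in> U" | v where "x \<in> U" "v \<in> U" "y = u + v"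
        | v where "y \<in> U" "v \<in> U" "x = u + v" | v w where "v \<in> U" "w \<in> U" "x = u + v" "y = u + w"
        using xy unfolding U'_def by blast
      then show ?thesis
      proof cases
        case 1 then show ?thesis using f UV by (simp add: g1)
      next
        case 2 then show ?thesis using mixed by simp
      next
        case 3
        then have "g y * g x = beta y x * g (y + x)" using mixed by simp
        then show ?thesis using sym[OF K] by (simp add: mult.commute add.commute)
      next
        case 4 then show ?thesis using both by simp
      qed
    qed
    moreover have "g 0 = 1" using UV f g1 by simp
    ultimately have "good U'" unfolding good_def by blast
    then have "card U' \<le> card U" by (rule max)
    moreover have "card U < card U'"
    proof (rule psubset_card_mono)
      show "finite U'" using \<open>U' \<subseteq> V\<close> V finite_subset by blast
      have "u + 0 \<in> U'" using UV unfolding U'_def by blast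
      then show "U \<subset> U'" using u by (auto simp: U'_def)
    qed
    ultimately show False by simp
  qed
  then show ?thesis using f by blast
qed

context spread_field
begin

lemma numeral_char_two [simp]:
  "(numeral (Num.Bit0 k) :: 'f) = 0" "(numeral (Num.Bit1 k) :: 'f) = 1"
  by (simp_all add: numeral_Bit0 numeral_Bit1)

text \<open>The coordinates of \<open>x = ca x + lam * cb x\<close> over \<open>Fq\<close>.\<close>

definition ca :: "'f \<Rightarrow> 'f" where "ca x = cj lam * x + lam * cj x"
definition cb :: "'f \<Rightarrow> 'f" where "cb x = x + cj x"

lemma ca_in_Fq: "x \<in> K \<Longrightarrow> ca x \<in> Fq"
  using lam_in_K by (simp add: ca_def Fq_def K_def cj_add cj_mult add.commute)

lemma cb_in_Fq: "x \<in> K \<Longrightarrow> cb x \<in> Fq"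
  by (simp add: cb_def trace_in_Fq)

lemma ca_add: "ca (x + y) = ca x + ca y" and cb_add: "cb (x + y) = cb x + cb y"
  by (simp_all add: ca_def cb_def cj_add algebra_simps)

lemma ca_0 [simp]: "ca 0 = 0" and cb_0 [simp]: "cb 0 = 0"
  by (simp_all add: ca_def cb_def)

text \<open>The first and third terms are symmetric, so quadratic refinements can absorb them into
  phases. The middle one is the noncommutative part, coming from translations and characters on
  \<open>Fq\<close>.\<close>

lemma chi_coordinates:
  "chi x y = psi (ca x * ca y + cb x * ca y + lam * cj lam * cb x * cb y)"
proof -
  have "((l + 1) * a + l * a') * ((l + 1) * b + l * b') + (a + a') * ((l + 1) * b + l * b')
      + l * (l + 1) * (a + a') * (b + b') = l * a * b' + (l + 1) * a' * b" for l a a' b b' :: 'f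
    by (simp add: algebra_simps)
  then show ?thesis unfolding chi_def ca_def cb_def cj_lam by simp
qed


lemma card_UNIV_eq_bij_Fq:
  assumes "CARD('n) = q"
  obtains idx :: "'n::finite \<Rightarrow> 'f" where "bij_betw idx UNIV Fq"
  using finite_same_card_bij[of "UNIV :: 'n set" Fq] assms card_Fq finite_Fq by auto

end

text \<open>With basis vectors labelled through \<open>idx\<close>, this sends the vector labelled
  \<open>t\<close> to \<open>h t\<close> times the one labelled \<open>t + a\<close>: a translation
  combined with a diagonal matrix.\<close>

definition monomial_mat :: "('n \<Rightarrow> 'f::plus) \<Rightarrow> 'f \<Rightarrow> ('f \<Rightarrow> complex) \<Rightarrow> complex^'n^'n" where
  "monomial_mat idx a h = (\<chi> i j. if idx i = idx j + a then h (idx j) else 0)"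

lemma scale_monomial_mat: "cmat_scale c (monomial_mat idx a h) = monomial_mat idx a (\<lambda>t. c * h t)"
  by (simp add: monomial_mat_def cmat_scale_def vec_eq_iff)

context spread_field
begin

context
  fixes idx :: "'n::finite \<Rightarrow> 'f"
  assumes idx: "bij_betw idx UNIV Fq"
begin

lemma idx_in_Fq: "idx i \<in> Fq"
  using idx by (auto simp: bij_betw_def)

lemma idx_eq_iff: "idx i = idx j \<longleftrightarrow> i = j"
  using idx by (auto simp: bij_betw_def inj_eq)

lemma idx_surj: "t \<in> Fq \<Longrightarrow> \<exists>i. idx i = t"
  using idx unfolding bij_betw_def by force

lemma monomial_mat_cong:
  "(\<And>t. t \<in> Fq \<Longrightarrow> h t = h' t) \<Longrightarrow> monomial_mat idx a h = monomial_mat idx a h'"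
  by (simp add: monomial_mat_def vec_eq_iff idx_in_Fq)

lemma monomial_mat_mult:
  assumes "a \<in> Fq" "c \<in> Fq"
  shows "monomial_mat idx a h ** monomial_mat idx c h' =
    monomial_mat idx (a + c) (\<lambda>t. h (t + c) * h' t)"
proof -
  have "(\<Sum>k\<in>UNIV. (if idx i = idx k + a then h (idx k) else 0) *
      (if idx k = idx j + c then h' (idx j) else 0)) =
    (if idx i = idx j + (a + c) then h (idx j + c) * h' (idx j) else 0)" for i j
  proof -
    obtain l where l: "idx l = idx j + c" using idx_surj Fq_closed(3)[OF idx_in_Fq assms(2)] by metis
    have "(\<Sum>k\<in>UNIV. (if idx i = idx k + a then h (idx k) else 0) *
        (if idx k = idx j + c then h' (idx j) else 0)) =
      (\<Sum>k\<in>UNIV. if k = l then (if idx i = idx l + a then h (idx l) * h' (idx j) else 0) else 0)"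
      by (intro sum.cong) (auto simp: l[symmetric] idx_eq_iff)
    also have "\<dots> = (if idx i = idx l + a then h (idx l) * h' (idx j) else 0)" by simp
    finally show ?thesis by (simp add: l ac_simps)
  qed
  then show ?thesis by (simp add: monomial_mat_def matrix_matrix_mult_def vec_eq_iff)
qed

lemma transpose_monomial_mat:
  "transpose (monomial_mat idx a h) = monomial_mat idx a (\<lambda>t. h (t + a))"
proof -
  have "idx j = idx i + a \<longleftrightarrow> idx i = idx j + a" for i j
    by (metis add.assoc add_0_right add_self)
  then show ?thesis by (auto simp: monomial_mat_def transpose_def vec_eq_iff)
qed

lemma monomial_mat_one: "monomial_mat idx 0 (\<lambda>_. 1) = mat 1"
  by (simp add: monomial_mat_def mat_def vec_eq_iff idx_eq_iff)

end

text \<open>\<open>E x\<close> combines translation by \<open>ca x\<close> with the character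
  \<open>psi (cb x * t)\<close>, and the phases \<open>f\<close> and \<open>g\<close> absorb the
  symmetric parts of \<open>chi\<close>. The matrix \<open>S\<close> is of the same monomial
  shape.\<close>

theorem exists_twisted_group_basis:
  assumes "CARD('n) = q"
  obtains E :: "'f \<Rightarrow> complex^'n^'n" and S :: "complex^'n^'n"
  where "E 0 = mat 1"
    and "\<And>x y. x \<in> K \<Longrightarrow> y \<in> K \<Longrightarrow> E x ** E y = cmat_scale (chi x y) (E (x + y))"
    and "\<And>x. x \<in> K \<Longrightarrow> S ** transpose (E x) = cmat_scale (chi x x) (E x ** S)"
    and "transpose S = - S" and "invertible S"
proof -
  obtain idx :: "'n \<Rightarrow> 'f" where idx: "bij_betw idx UNIV Fq"
    using card_UNIV_eq_bij_Fq[OF assms] .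
  define dl where "dl = lam * cj lam"
  have dl: "dl \<in> Fq" unfolding dl_def by (rule norm_in_Fq[OF lam_in_K])
  \<comment> \<open>The shift \<open>s\<close> in \<open>S\<close> is the square root of the norm of
    \<open>lam\<close>. Invariance of \<open>psi\<close> under squaring gives
    \<open>psi s = -1\<close>, whence both the skew symmetry of \<open>S\<close> and
    \<open>S ** S = - mat 1\<close>.\<close>
  obtain s where s: "s \<in> Fq" "s ^ 2 = dl" using Fq_square_root[OF dl] by blast
  have psi_s: "psi s = -1" using psi_square[OF s(1)] psi_norm_lam s(2) by (simp add: dl_def)
  have ref: "\<exists>f. f 0 = 1 \<and> (\<forall>x\<in>Fq. \<forall>y\<in>Fq. f x * f y = psi (c * x * y) * f (x + y))"
    if c: "c \<in> Fq" for c
  proof (rule exists_quadratic_refinement)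
    show "psi (c * x * (y + z)) = psi (c * x * y) * psi (c * x * z)"
      if "x \<in> Fq" "y \<in> Fq" "z \<in> Fq" for x y z
      unfolding distrib_left by (intro psi_add Fq_closed that c)
  qed (auto simp: finite_Fq Fq_closed mult_ac)
  obtain f where f: "f 0 = 1" "\<And>x y. x \<in> Fq \<Longrightarrow> y \<in> Fq \<Longrightarrow> f x * f y = psi (x * y) * f (x + y)"
    using ref[OF Fq_closed(2)] by auto
  obtain g where g: "g 0 = 1" "\<And>x y. x \<in> Fq \<Longrightarrow> y \<in> Fq \<Longrightarrow> g x * g y = psi (dl * x * y) * g (x + y)"
    using ref[OF dl] by auto
  define E where "E x = monomial_mat idx (ca x) (\<lambda>t. f (ca x) * g (cb x) * psi (cb x * t))" for x
  define S where "S = monomial_mat idx s psi"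
  have S_sq: "S ** S = cmat_scale (-1) (mat 1)"
  proof -
    have "psi (t + s) * psi t = -1" if "t \<in> Fq" for t
      using psi_cases[of t] by (auto simp: psi_add that s psi_s)
    then show ?thesis
      unfolding S_def monomial_mat_mult[OF idx s(1) s(1)] monomial_mat_one[OF idx, symmetric]
        scale_monomial_mat add_self
      by (intro monomial_mat_cong[OF idx]) simp
  qed
  have neg: "cmat_scale (-1) A = - A" for A :: "complex^'n^'n"
    by (simp add: cmat_scale_def vec_eq_iff)
  show ?thesis
  proof
    show "E 0 = mat 1"
      using f(1) g(1) by (simp add: E_def monomial_mat_one[OF idx])
    show "E x ** E y = cmat_scale (chi x y) (E (x + y))" if "x \<in> K" "y \<in> K" for x y
    proof -
      have Fq: "ca x \<in> Fq" "ca y \<in> Fq" "cb x \<in> Fq" "cb y \<in> Fq"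
        using that by (simp_all add: ca_in_Fq cb_in_Fq)
      \<comment> \<open>The outer factors are matched by \<open>f\<close> and \<open>g\<close>; the
        middle one arises when the character of \<open>E x\<close> is evaluated after the
        translation of \<open>E y\<close>.\<close>
      have *: "chi x y = psi (ca x * ca y) * psi (cb x * ca y) * psi (dl * cb x * cb y)"
        unfolding chi_coordinates dl_def[symmetric] using Fq dl by (simp add: psi_add Fq_closed)
      have "f (ca x) * g (cb x) * psi (cb x * (t + ca y)) * (f (ca y) * g (cb y) * psi (cb y * t)) =
        chi x y * (f (ca (x + y)) * g (cb (x + y)) * psi (cb (x + y) * t))" if t: "t \<in> Fq" for t
      proof -
        have "psi (cb x * (t + ca y)) = psi (cb x * t) * psi (cb x * ca y)"
          "psi (cb (x + y) * t) = psi (cb x * t) * psi (cb y * t)"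
          unfolding distrib_left distrib_right cb_add by (intro psi_add Fq_closed Fq t)+
        then have "f (ca x) * g (cb x) * psi (cb x * (t + ca y)) * (f (ca y) * g (cb y) * psi (cb y * t)) =
          (f (ca x) * f (ca y)) * (g (cb x) * g (cb y)) * psi (cb x * ca y) * psi (cb (x + y) * t)"
          by (simp add: mult_ac)
        also have "\<dots> = chi x y * (f (ca (x + y)) * g (cb (x + y)) * psi (cb (x + y) * t))"
          unfolding f(2)[OF Fq(1,2)] g(2)[OF Fq(3,4)] * ca_add cb_add by (simp add: mult_ac)
        finally show ?thesis .
      qed
      then show ?thesis
        unfolding E_def monomial_mat_mult[OF idx Fq(1,2)] scale_monomial_mat ca_add[of x y, symmetric]
        by (intro monomial_mat_cong[OF idx])
    qed
    show "S ** transpose (E x) = cmat_scale (chi x x) (E x ** S)" if "x \<in> K" for x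
    proof -
      have Fq: "ca x \<in> Fq" "cb x \<in> Fq" using that by (simp_all add: ca_in_Fq cb_in_Fq)
      \<comment> \<open>The term quadratic in \<open>cb x\<close> becomes linear under
        \<open>psi\<close>, which is what a translation by \<open>s\<close> can produce.\<close>
      have bs: "psi (dl * cb x * cb x) = psi (cb x * s)"
      proof -
        have "dl * cb x * cb x = (cb x * s) ^ 2"
          unfolding s(2)[symmetric] power2_eq_square by (simp only: mult_ac)
        then show ?thesis using psi_square[of "cb x * s"] Fq s by (simp only: Fq_closed)
      qed
      have *: "chi x x = psi (ca x) * psi (cb x * ca x) * psi (cb x * s)"
        unfolding chi_coordinates dl_def[symmetric] bs[symmetric]
        using Fq dl psi_square[OF Fq(1)] by (simp add: psi_add Fq_closed power2_eq_square)
      have "psi (t + ca x) * (f (ca x) * g (cb x) * psi (cb x * (t + ca x))) =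
        chi x x * (f (ca x) * g (cb x) * psi (cb x * (t + s)) * psi t)" if t: "t \<in> Fq" for t
      proof -
        have "psi (cb x * (t + ca x)) = psi (cb x * t) * psi (cb x * ca x)"
          "psi (cb x * (t + s)) = psi (cb x * t) * psi (cb x * s)"
          unfolding distrib_left by (intro psi_add Fq_closed Fq t s)+
        moreover have "psi (t + ca x) = psi t * psi (ca x)" by (intro psi_add Fq t)
        moreover have "psi (cb x * s) * (psi (cb x * s) * r) = r" for r
          by (simp flip: mult.assoc)
        ultimately show ?thesis by (simp add: * mult_ac)
      qed
      then show ?thesis
        unfolding S_def E_def transpose_monomial_mat[OF idx] monomial_mat_mult[OF idx Fq(1) s(1)]
          monomial_mat_mult[OF idx s(1) Fq(1)] scale_monomial_mat add.commute[of s]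
        by (intro monomial_mat_cong[OF idx])
    qed
    have "transpose S = cmat_scale (-1) S"
      unfolding S_def transpose_monomial_mat[OF idx] scale_monomial_mat
      by (intro monomial_mat_cong[OF idx]) (simp add: psi_add s psi_s)
    then show "transpose S = - S" by (simp add: neg)
    have "S ** (- S) = mat 1" "(- S) ** S = mat 1"
      using S_sq by (simp_all add: neg matrix_matrix_mult_def vec_eq_iff sum_negf)
    then show "invertible S" unfolding invertible_def by blast
  qed
qed

end

section \<open>Congruence of skew-symmetric matrices\<close>

text \<open>Bilinear, without complex conjugation, since congruence here uses the plain
  transpose.\<close>

definition bform :: "complex^'n^'n \<Rightarrow> complex^'n \<Rightarrow> complex^'n \<Rightarrow> complex" where
  "bform S u v = (\<Sum>i\<in>UNIV. \<Sum>j\<in>UNIV. u $ i * S $ i $ j * v $ j)"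

lemma bform_add_right: "bform S u (v + v') = bform S u v + bform S u v'"
  and bform_scale_right: "bform S u (c *s v) = c * bform S u v"
  and bform_diff_right: "bform S u (v - v') = bform S u v - bform S u v'"
  and bform_zero_right: "bform S u 0 = 0"
  by (simp_all add: bform_def algebra_simps sum.distrib sum_subtractf sum_distrib_left)

lemma bform_sum_right: "bform S u (\<Sum>i\<in>I. v i) = (\<Sum>i\<in>I. bform S u (v i))"
  by (induction I rule: infinite_finite_induct) (simp_all add: bform_zero_right bform_add_right)

lemma bform_skew:
  assumes "transpose S = - S"
  shows "bform S u v = - bform S v u"
proof -
  have S: "S $ i $ j = - (S $ j $ i)" for i j
  proof -
    have "transpose S $ j $ i = (- S) $ j $ i" by (simp only: assms)
    then show ?thesis by (simp add: transpose_def)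
  qed
  have "bform S u v = (\<Sum>j\<in>UNIV. \<Sum>i\<in>UNIV. u $ i * S $ i $ j * v $ j)"
    unfolding bform_def by (rule sum.swap)
  also have "\<dots> = (\<Sum>j\<in>UNIV. \<Sum>i\<in>UNIV. - (v $ j * S $ j $ i * u $ i))"
    by (intro sum.cong refl, subst S) simp
  finally show ?thesis by (simp add: bform_def sum_negf)
qed

lemma bform_nondegenerate:
  assumes "invertible S" "v \<noteq> 0"
  obtains w where "bform S v w \<noteq> 0"
proof -
  have "transpose S *v v \<noteq> 0"
  proof
    assume 0: "transpose S *v v = 0"
    obtain S' where "S ** S' = mat 1" using assms(1) unfolding invertible_def by blast
    then have "transpose S' ** transpose S = mat 1" by (metis matrix_transpose_mul transpose_mat)
    then have "v = transpose S' *v (transpose S *v v)"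
      unfolding matrix_vector_mul_assoc by simp
    then show False using assms(2) unfolding 0 by simp
  qed
  then obtain j where j: "(transpose S *v v) $ j \<noteq> 0" by (auto simp: vec_eq_iff)
  have "bform S v (axis j 1) = (\<Sum>i\<in>UNIV. v $ i * S $ i $ j)"
    unfolding bform_def by (intro sum.cong) (auto simp: axis_def if_distrib cong: if_cong)
  also have "\<dots> = (transpose S *v v) $ j"
    by (simp add: matrix_vector_mult_def transpose_def mult.commute)
  finally show ?thesis using j that by metis
qed

text \<open>Symplectic Gram-Schmidt: each step adds a hyperbolic pair orthogonal to those already
  found.\<close>

lemma exists_hyperbolic_family:
  fixes S :: "complex^'n^'n"
  assumes S: "invertible S" "transpose S = - S" and "2 * k \<le> CARD('n)"
  shows "\<exists>e f :: nat \<Rightarrow> complex^'n. \<forall>i<k. \<forall>j<k.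
    bform S (e i) (e j) = 0 \<and> bform S (f i) (f j) = 0 \<and>
    bform S (e i) (f j) = (if i = j then 1 else 0) \<and> bform S (f i) (e j) = (if i = j then -1 else 0)"
  using assms(3)
proof (induction k)
  case 0
  then show ?case by simp
next
  case (Suc k)
  then obtain e f :: "nat \<Rightarrow> complex^'n" where ef: "\<And>i j. i < k \<Longrightarrow> j < k \<Longrightarrow>
    bform S (e i) (e j) = 0 \<and> bform S (f i) (f j) = 0 \<and>
    bform S (e i) (f j) = (if i = j then 1 else 0) \<and> bform S (f i) (e j) = (if i = j then -1 else 0)"
    by auto
  \<comment> \<open>The projection to the span of the pairs found so far: \<open>pr u\<close> has
    the same products as \<open>u\<close> with every \<open>e j\<close> and \<open>f j\<close>, so
    \<open>u - pr u\<close> is orthogonal to them.\<close>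
  define pr where "pr u = (\<Sum>i<k. bform S (e i) u *s f i - bform S (f i) u *s e i)" for u
  have e_pr: "bform S (e j) (pr u) = bform S (e j) u" and f_pr: "bform S (f j) (pr u) = bform S (f j) u"
    if "j < k" for j u
    using that by (simp_all add: pr_def bform_sum_right bform_diff_right bform_scale_right ef if_distrib
        sum_subtractf sum_negf cong: if_cong)
  define F where "F = e ` {..<k} \<union> f ` {..<k}"
  have "finite F" "card F \<le> 2 * k"
    using card_Un_le[of "e ` {..<k}" "f ` {..<k}"] card_image_le[of "{..<k}" e]
      card_image_le[of "{..<k}" f] by (auto simp: F_def)
  then have "vec.dim (vec.span F) \<le> 2 * k"
    using vec.dim_le_card[of "vec.span F" F] by simp
  \<comment> \<open>At most \<open>2 * k\<close> vectors span \<open>F\<close>, while the dimension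
    is at least \<open>2 * Suc k\<close>.\<close>
  then have "vec.span F \<noteq> UNIV"
    using vec_dim_card[where 'a=complex and 'n='n] Suc.prems by (metis Suc_n_not_le_n le_trans mult_Suc_right add_2_eq_Suc Suc_leD)
  then obtain u where u: "u \<notin> vec.span F" by blast
  have "pr u \<in> vec.span F"
    unfolding pr_def F_def
    by (intro vec.span_sum vec.span_diff vec.span_scale vec.span_base) auto
  define v where "v = u - pr u"
  have "v \<noteq> 0" using u \<open>pr u \<in> _\<close> by (auto simp: v_def)
  then obtain w0 where w0: "bform S v w0 \<noteq> 0" using bform_nondegenerate[OF S(1)] by blast
  \<comment> \<open>Since \<open>v\<close> is orthogonal to the earlier pairs, subtracting
    \<open>pr w0\<close> leaves its product with \<open>v\<close> unchanged, and the scaling makes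
    that product one.\<close>
  define w where "w = (1 / bform S v w0) *s (w0 - pr w0)"
  have v_orth: "bform S (e j) v = 0" "bform S (f j) v = 0" if "j < k" for j
    using that by (simp_all add: v_def bform_diff_right e_pr f_pr)
  have v_orth': "bform S v (e j) = 0" "bform S v (f j) = 0" if "j < k" for j
    using v_orth[OF that] bform_skew[OF S(2), of v] by simp_all
  have w_orth: "bform S (e j) w = 0" "bform S (f j) w = 0" if "j < k" for j
    using that by (simp_all add: w_def bform_diff_right bform_scale_right e_pr f_pr)
  have w_orth': "bform S w (e j) = 0" "bform S w (f j) = 0" if "j < k" for j
    using w_orth[OF that] bform_skew[OF S(2), of w] by simp_all
  have "bform S v (pr w0) = 0"
    by (simp add: pr_def bform_sum_right bform_diff_right bform_scale_right v_orth')
  then have vw: "bform S v w = 1" using w0 by (simp add: w_def bform_scale_right bform_diff_right)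
  then have wv: "bform S w v = -1" using bform_skew[OF S(2), of w v] by simp
  have self: "bform S x x = 0" for x using bform_skew[OF S(2), of x x] by simp
  show ?case
    by (rule exI[of _ "e(k := v)"], rule exI[of _ "f(k := w)"])
       (auto simp: less_Suc_eq ef v_orth v_orth' w_orth w_orth' vw wv self)
qed

lemma matrix_congruence_entry:
  fixes A S :: "complex^'n^'n"
  shows "(A ** S ** transpose A) $ i $ j = bform S (A $ i) (A $ j)"
  unfolding bform_def matrix_matrix_mult_def transpose_def
  by (simp add: sum_distrib_right) (subst sum.swap, rule refl)

text \<open>In the order given by \<open>pos\<close>, \<open>J\<close> is block diagonal with
  two-by-two skew blocks. The rows of \<open>P\<close> are a hyperbolic basis for \<open>S\<close>,
  so the congruence computes their Gram matrix.\<close>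

lemma exists_symplectic_congruence_to_standard:
  fixes pos :: "'n::finite \<Rightarrow> nat"
  assumes pos: "bij_betw pos UNIV {..<2 * k}"
  obtains J :: "complex^'n^'n" where "invertible J"
    and "\<And>S :: complex^'n^'n. invertible S \<Longrightarrow> transpose S = - S \<Longrightarrow> \<exists>P :: complex^'n^'n. P ** S ** transpose P = J"
proof -
  have n: "CARD('n) = 2 * k" using bij_betw_same_card[OF pos] by simp
  have lt: "pos i < 2 * k" for i using pos by (auto simp: bij_betw_def)
  have inj: "pos i = pos j \<longleftrightarrow> i = j" for i j using pos by (auto simp: bij_betw_def inj_eq)
  \<comment> \<open>This exchanges the two members \<open>2 * r\<close> and \<open>2 * r + 1\<close>
    of each block.\<close>
  define sw where "sw r = (if even r then Suc r else r - 1)" for r :: nat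
  define J :: "complex^'n^'n" where
    "J = (\<chi> i j. if pos j = sw (pos i) then (if even (pos i) then 1 else -1) else 0)"
  have sw: "r div 2 = r' div 2 \<and> r \<noteq> r' \<longleftrightarrow> r' = sw r" for r r' :: nat
    by (cases "even r") (simp_all add: sw_def, presburger+)
  have sw_lt: "sw r < 2 * k" if "r < 2 * k" for r using that unfolding sw_def by (cases "even r") (simp_all, presburger)
  have sw_sw: "sw (sw r) = r" "even (sw r) \<longleftrightarrow> odd r" for r unfolding sw_def by auto
  have J2: "J ** J = - mat 1"
  proof -
    have "(J ** J) $ i $ j = (- mat 1) $ i $ j" for i j
    proof -
      obtain l where l: "pos l = sw (pos i)"
        using pos sw_lt[OF lt[of i]] unfolding bij_betw_def by (metis imageE lessThan_iff)
      have "(J ** J) $ i $ j = (\<Sum>r\<in>UNIV. if r = l then J $ i $ l * J $ l $ j else 0)"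
        unfolding matrix_matrix_mult_def vec_lambda_beta
        by (intro sum.cong) (auto simp: J_def l[symmetric] inj)
      also have "\<dots> = J $ i $ l * J $ l $ j" by simp
      also have "\<dots> = (- mat 1) $ i $ j"
        by (auto simp: J_def l sw_sw mat_def inj)
      finally show ?thesis .
    qed
    then show ?thesis by (simp add: vec_eq_iff)
  qed
  have "J ** (- J) = mat 1" "(- J) ** J = mat 1"
    using J2 by (simp_all add: matrix_matrix_mult_def vec_eq_iff sum_negf)
  then have "invertible J" unfolding invertible_def by blast
  moreover have "\<exists>P :: complex^'n^'n. P ** S ** transpose P = J"
    if S: "invertible S" "transpose S = - S" for S :: "complex^'n^'n"
  proof -
    obtain e f :: "nat \<Rightarrow> complex^'n" where ef: "\<And>i j. i < k \<Longrightarrow> j < k \<Longrightarrow>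
      bform S (e i) (e j) = 0 \<and> bform S (f i) (f j) = 0 \<and>
      bform S (e i) (f j) = (if i = j then 1 else 0) \<and> bform S (f i) (e j) = (if i = j then -1 else 0)"
      using exists_hyperbolic_family[OF S, of k] n by auto
    define P :: "complex^'n^'n" where
      "P = (\<chi> i. if even (pos i) then e (pos i div 2) else f (pos i div 2))"
    have "bform S (P $ i) (P $ j) = J $ i $ j" for i j
    proof -
      have "pos i div 2 < k" "pos j div 2 < k" using lt[of i] lt[of j] by auto
      moreover have "pos i = pos j \<longleftrightarrow> pos i div 2 = pos j div 2 \<and> (even (pos i) \<longleftrightarrow> even (pos j))"
        by presburger
      ultimately show ?thesis by (auto simp: P_def J_def ef sw[symmetric])
    qed
    then have "P ** S ** transpose P = J"
      by (simp add: vec_eq_iff matrix_congruence_entry)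
    then show ?thesis by blast
  qed
  ultimately show ?thesis using that by blast
qed

text \<open>Both matrices are congruent to the same \<open>J\<close>. This allows the skew matrix
  built together with the basis to be replaced by an arbitrary given one.\<close>

theorem skew_matrices_congruent:
  fixes S S' :: "complex^'n^'n"
  assumes "even CARD('n)" "invertible S" "transpose S = - S" "invertible S'" "transpose S' = - S'"
  obtains P where "invertible P" "P ** S ** transpose P = S'"
proof -
  obtain k where k: "CARD('n) = 2 * k" using assms(1) by blast
  then obtain pos :: "'n \<Rightarrow> nat" where "bij_betw pos UNIV {..<2 * k}"
    using finite_same_card_bij[of "UNIV :: 'n set" "{..<2 * k}"] by auto
  then obtain J :: "complex^'n^'n" where J: "invertible J"
    "\<And>S :: complex^'n^'n. invertible S \<Longrightarrow> transpose S = - S \<Longrightarrow> \<exists>P :: complex^'n^'n. P ** S ** transpose P = J"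
    using exists_symplectic_congruence_to_standard by blast
  obtain P where P: "P ** S ** transpose P = J" using J(2)[OF assms(2,3)] by blast
  obtain Q where Q: "Q ** S' ** transpose Q = J" using J(2)[OF assms(4,5)] by blast
  \<comment> \<open>Invertibility of the congruence matrices is inherited from \<open>J\<close>,
    which provides a right inverse.\<close>
  have inv: "invertible A" if "A ** R ** transpose A = J" for A R :: "complex^'n^'n"
  proof -
    obtain J' where "J ** J' = mat 1" using J(1) invertible_def by blast
    then have "A ** (R ** transpose A ** J') = mat 1"
      using that by (simp add: matrix_mul_assoc)
    then show ?thesis unfolding invertible_right_inverse by blast
  qed
  obtain Q' where Q': "Q' ** Q = mat 1" "Q ** Q' = mat 1"
    using inv[OF Q] unfolding invertible_def by blast
  have "(Q' ** P) ** S ** transpose (Q' ** P) = Q' ** (P ** S ** transpose P) ** transpose Q'"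
    by (simp add: matrix_transpose_mul matrix_mul_assoc)
  also have "\<dots> = (Q' ** Q) ** S' ** transpose (Q' ** Q)"
    unfolding P Q[symmetric] by (simp only: matrix_transpose_mul matrix_mul_assoc)
  also have "\<dots> = S'" using Q' by (simp add: transpose_mat)
  finally have "(Q' ** P) ** S ** transpose (Q' ** P) = S'" .
  moreover have "invertible (Q' ** P)"
    using inv[OF P] Q' invertible_mult unfolding invertible_def by blast
  ultimately show ?thesis using that by blast
qed

section \<open>Orthogonal decomposition of the symplectic algebra\<close>

lemma cmat_scale_nth: "cmat_scale c A $ i $ j = c * A $ i $ j"
  by (simp add: cmat_scale_def)

lemma cmat_scale_mult:
  "cmat_scale c A ** B = cmat_scale c (A ** B)" "A ** cmat_scale c B = cmat_scale c (A ** B)"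
  by (simp_all add: matrix_matrix_mult_def vec_eq_iff cmat_scale_nth sum_distrib_left mult_ac)

lemma transpose_cmat_scale: "transpose (cmat_scale c A) = cmat_scale c (transpose A)"
  by (simp add: transpose_def vec_eq_iff cmat_scale_nth)

lemma matrix_mult_sum:
  fixes A :: "complex^'n^'n"
  shows "A ** (\<Sum>i\<in>I. B i) = (\<Sum>i\<in>I. A ** B i)" "(\<Sum>i\<in>I. B i) ** A = (\<Sum>i\<in>I. B i ** A)"
  by (induction I rule: infinite_finite_induct)
     (simp_all add: matrix_matrix_mult_def vec_eq_iff sum.distrib algebra_simps)

lemma transpose_sum: "transpose (\<Sum>i\<in>I. B i) = (\<Sum>i\<in>I. transpose (B i :: complex^'n^'n))"
  by (simp add: transpose_def vec_eq_iff)

lemma lie_bracket_sum: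
  "lie_bracket A (\<Sum>i\<in>I. B i) = (\<Sum>i\<in>I. lie_bracket A (B i))"
  "lie_bracket (\<Sum>i\<in>I. B i) A = (\<Sum>i\<in>I. lie_bracket (B i) A)"
  by (simp_all add: lie_bracket_def matrix_mult_sum sum_subtractf)

lemma lie_bracket_scale:
  "lie_bracket A (cmat_scale c B) = cmat_scale c (lie_bracket A B)"
  "lie_bracket (cmat_scale c A) B = cmat_scale c (lie_bracket A B)"
  by (simp_all add: lie_bracket_def cmat_scale_mult cmat.scale_right_diff_distrib)

lemma lie_bracket_add:
  "lie_bracket A (B + C) = lie_bracket A B + lie_bracket A C"
  by (simp add: lie_bracket_def matrix_matrix_mult_def vec_eq_iff algebra_simps sum.distrib)

text \<open>The matrix units span. The bound serves to show that the \<open>q * q\<close>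
  independent matrices \<open>E x\<close> span as well.\<close>

lemma cmat_independent_card_le:
  fixes B :: "(complex^'n^'n) set"
  assumes "cmat.independent B"
  shows "card B \<le> CARD('n) * CARD('n)"
proof -
  let ?E = "\<lambda>(i,j). (\<chi> k l. if k = i \<and> l = j then 1 else 0) :: complex^'n^'n"
  have "A \<in> cmat.span (range ?E)" for A
  proof -
    have "(\<Sum>p\<in>UNIV. cmat_scale (A $ fst p $ snd p) (?E p)) $ k $ l = A $ k $ l" for k l
    proof -
      have "(\<Sum>p\<in>UNIV. cmat_scale (A $ fst p $ snd p) (?E p)) $ k $ l =
          (\<Sum>p\<in>UNIV. if p = (k,l) then A $ k $ l else 0)"
        unfolding sum_component by (rule sum.cong) (auto simp: cmat_scale_nth split: if_splits)
      then show ?thesis by simp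
    qed
    then have "A = (\<Sum>p\<in>UNIV. cmat_scale (A $ fst p $ snd p) (?E p))"
      by (simp add: vec_eq_iff)
    also have "\<dots> \<in> cmat.span (range ?E)"
      by (intro cmat.span_sum cmat.span_scale cmat.span_base) auto
    finally show ?thesis .
  qed
  then have "card B \<le> card (range ?E)"
    using cmat.independent_span_bound[of "range ?E" B] assms by auto
  also have "\<dots> \<le> CARD('n \<times> 'n)" by (rule card_image_le) simp
  finally show ?thesis by (simp add: card_cartesian_product flip: UNIV_Times_UNIV)
qed

text \<open>The arguments here use only these relations, not the monomial form of the matrices, so a
  basis transported to any given \<open>S\<close> fits too.\<close>

locale twisted_basis = spread_field m lam om for m and lam om :: "'f::alg_closed_field" +
  fixes E :: "'f \<Rightarrow> complex^'n^'n" and S :: "complex^'n^'n"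
  assumes card_n: "CARD('n) = q"
    and E_0: "E 0 = mat 1"
    and E_mult: "\<And>x y. x \<in> K \<Longrightarrow> y \<in> K \<Longrightarrow> E x ** E y = cmat_scale (chi x y) (E (x + y))"
    and E_transpose: "\<And>x. x \<in> K \<Longrightarrow> S ** transpose (E x) = cmat_scale (chi x x) (E x ** S)"
    and inv_S: "invertible S"
begin

text \<open>The inverse of \<open>E x\<close> is \<open>chi x x\<close> times \<open>E x\<close>,
  and only \<open>E 0\<close> has nonzero trace, so this trace reads off the coefficient of
  \<open>E x\<close> in \<open>A\<close>.\<close>

definition coef :: "'f \<Rightarrow> complex^'n^'n \<Rightarrow> complex" where
  "coef x A = chi x x * trace (E x ** A) / of_nat q"

definition supp_space :: "'f set \<Rightarrow> (complex^'n^'n) set" where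
  "supp_space D = {A. \<forall>x\<in>K - D. coef x A = 0}"

definition L :: "(complex^'n^'n) set" where "L = supp_space T"
definition Hs :: "nat \<Rightarrow> (complex^'n^'n) set" where "Hs i = supp_space (W i \<inter> T)"

section \<open>Coefficients with respect to the basis \<open>E x\<close>\<close>

lemma trace_cmat_scale: "trace (cmat_scale c A) = c * trace A"
  by (simp add: trace_def cmat_scale_nth sum_distrib_left)

text \<open>For nonzero \<open>x\<close> some \<open>E y\<close> anticommutes with
  \<open>E x\<close>. Cyclicity of the trace then equates the trace of \<open>E x\<close> with its
  negative.\<close>

lemma trace_E:
  assumes "x \<in> K"
  shows "trace (E x) = (if x = 0 then of_nat q else 0)"
proof (cases "x = 0")
  case True
  then show ?thesis by (simp add: E_0 trace_def mat_def card_n)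
next
  case False
  then obtain y where y: "y \<in> K" "chi x y \<noteq> chi y x" using chi_nondegenerate[OF assms] by blast
  have xy: "x + y \<in> K" using assms y K_closed by blast
  have "y + (x + y) = x" "x + y + y = x" by (simp_all add: add.assoc add.left_commute[of y])
  then have "E y ** (E x ** E y) = cmat_scale (chi x y * (chi y x * chi y y)) (E x)"
    "(E x ** E y) ** E y = cmat_scale (chi x y * (chi x y * chi y y)) (E x)"
    using assms y xy by (simp_all add: E_mult cmat_scale_mult chi_add_left chi_add_right)
  moreover have "trace (E y ** (E x ** E y)) = trace ((E x ** E y) ** E y)"
    by (rule trace_mul_sym)
  ultimately have "chi x y * (chi y x * chi y y) * trace (E x) = chi x y * (chi x y * chi y y) * trace (E x)"
    by (simp only: trace_cmat_scale)
  then show ?thesis using y False by (simp add: mult.assoc)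
qed

lemma coef_add: "coef x (A + B) = coef x A + coef x B"
  by (simp add: coef_def trace_def matrix_matrix_mult_def algebra_simps sum.distrib add_divide_distrib)

lemma coef_scale: "coef x (cmat_scale c A) = c * coef x A"
  by (simp add: coef_def cmat_scale_mult trace_cmat_scale)

lemma coef_0 [simp]: "coef x 0 = 0"
  using coef_scale[of x 0 0] by simp

lemma coef_sum: "coef x (\<Sum>i\<in>I. A i) = (\<Sum>i\<in>I. coef x (A i))"
  by (induction I rule: infinite_finite_induct) (simp_all add: coef_add)

lemma coef_E:
  assumes "x \<in> K" "y \<in> K"
  shows "coef x (E y) = (if x = y then 1 else 0)"
proof -
  have "x + y \<in> K" using assms K_closed by blast
  then show ?thesis
    using assms q_gt_1
    by (auto simp: coef_def E_mult trace_cmat_scale trace_E add_eq_0_iff_eq)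
qed

lemma coef_sum_E:
  assumes "D \<subseteq> K" "x \<in> K"
  shows "coef x (\<Sum>y\<in>D. cmat_scale (c y) (E y)) = (if x \<in> D then c x else 0)"
proof -
  have "finite D" using assms finite_K finite_subset by blast
  have "coef x (\<Sum>y\<in>D. cmat_scale (c y) (E y)) = (\<Sum>y\<in>D. if x = y then c x else 0)"
    unfolding coef_sum coef_scale using assms by (intro sum.cong) (auto simp: coef_E subset_iff)
  then show ?thesis using \<open>finite D\<close> by simp
qed

lemma inj_on_E: "inj_on E K"
  using coef_E by (intro inj_onI) (metis zero_neq_one)

lemma independent_E:
  assumes "D \<subseteq> K"
  shows "cmat.independent (E ` D)"
proof (rule cmat.independent_if_scalars_zero)
  show "finite (E ` D)" using assms finite_K finite_subset by blast
  fix c A assume c: "(\<Sum>A\<in>E ` D. cmat_scale (c A) A) = 0" and "A \<in> E ` D"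
  then obtain x where x: "x \<in> D" "A = E x" by blast
  have "(\<Sum>y\<in>D. cmat_scale (c (E y)) (E y)) = 0"
    using c sum.reindex[of E D "\<lambda>A. cmat_scale (c A) A"] inj_on_subset[OF inj_on_E assms]
    by (simp add: o_def)
  then show "c A = 0" using coef_sum_E[OF assms, of x "\<lambda>y. c (E y)"] x assms by auto
qed

text \<open>One matrix outside the span would give \<open>q * q + 1\<close> independent
  matrices.\<close>

lemma span_E: "cmat.span (E ` K) = UNIV"
proof (rule ccontr)
  assume "cmat.span (E ` K) \<noteq> UNIV"
  then obtain A where A: "A \<notin> cmat.span (E ` K)" by blast
  then have "cmat.independent (insert A (E ` K))" "A \<notin> E ` K"
    using independent_E[of K] cmat.independent_insertI cmat.span_superset by blast+
  then have "Suc (card (E ` K)) \<le> q * q"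
    using cmat_independent_card_le[of "insert A (E ` K)"] finite_K by (simp add: card_n)
  then show False by (simp add: card_image inj_on_E card_K)
qed

lemma expansion: "A = (\<Sum>x\<in>K. cmat_scale (coef x A) (E x))"
proof -
  have "A \<in> cmat.span (E ` K)" by (simp add: span_E)
  then show ?thesis
  proof (induction rule: cmat.span_induct_alt)
    case base
    then show ?case by simp
  next
    case (step c B A)
    then obtain y where y: "y \<in> K" "B = E y" by blast
    have "(\<Sum>x\<in>K. cmat_scale (coef x B) (E x)) = (\<Sum>x\<in>K. if x = y then E x else 0)"
      using y by (intro sum.cong) (auto simp: coef_E)
    also have "\<dots> = B" using y finite_K by simp
    finally have B: "(\<Sum>x\<in>K. cmat_scale (coef x B) (E x)) = B" .
    have "(\<Sum>x\<in>K. cmat_scale (coef x (cmat_scale c B + A)) (E x)) =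
      cmat_scale c (\<Sum>x\<in>K. cmat_scale (coef x B) (E x)) + (\<Sum>x\<in>K. cmat_scale (coef x A) (E x))"
      by (simp add: coef_add coef_scale cmat.scale_left_distrib sum.distrib cmat.scale_sum_right)
    then show ?case using B step by simp
  qed
qed

lemma eq_iff_coef: "A = B \<longleftrightarrow> (\<forall>x\<in>K. coef x A = coef x B)"
proof
  assume "\<forall>x\<in>K. coef x A = coef x B"
  then have "(\<Sum>x\<in>K. cmat_scale (coef x A) (E x)) = (\<Sum>x\<in>K. cmat_scale (coef x B) (E x))"
    by (intro sum.cong) auto
  then show "A = B" by (rule trans[OF expansion trans[OF _ expansion[symmetric]]])
qed simp

lemma supp_expansion:
  assumes "D \<subseteq> K" "A \<in> supp_space D"
  shows "A = (\<Sum>x\<in>D. cmat_scale (coef x A) (E x))"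
proof -
  have "(\<Sum>x\<in>K. cmat_scale (coef x A) (E x)) = (\<Sum>x\<in>D. cmat_scale (coef x A) (E x))"
    using assms finite_K by (intro sum.mono_neutral_right) (auto simp: supp_space_def)
  then show ?thesis by (rule trans[OF expansion])
qed

lemma sum_in_supp_space: "D \<subseteq> K \<Longrightarrow> (\<Sum>x\<in>D. cmat_scale (c x) (E x)) \<in> supp_space D"
  by (simp add: supp_space_def coef_sum_E)

lemma E_in_supp_space: "x \<in> D \<Longrightarrow> D \<subseteq> K \<Longrightarrow> E x \<in> supp_space D"
  by (auto simp: supp_space_def coef_E subset_iff)

lemma subspace_supp_space: "cmat.subspace (supp_space D)"
  by (auto simp: cmat.subspace_def supp_space_def coef_add coef_scale)

lemma supp_space_mono: "D \<subseteq> D' \<Longrightarrow> supp_space D \<subseteq> supp_space D'"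
  by (auto simp: supp_space_def)

lemma span_E_eq_supp_space:
  assumes "D \<subseteq> K"
  shows "cmat.span (E ` D) = supp_space D"
proof
  show "cmat.span (E ` D) \<subseteq> supp_space D"
    using E_in_supp_space assms subspace_supp_space by (intro cmat.span_minimal) auto
  show "supp_space D \<subseteq> cmat.span (E ` D)"
  proof
    fix A assume "A \<in> supp_space D"
    then have "A = (\<Sum>x\<in>D. cmat_scale (coef x A) (E x))" by (rule supp_expansion[OF assms])
    also have "\<dots> \<in> cmat.span (E ` D)"
      by (intro cmat.span_sum cmat.span_scale cmat.span_base) auto
    finally show "A \<in> cmat.span (E ` D)" .
  qed
qed

section \<open>The symplectic algebra and its decomposition along lines\<close>

lemma T_subset_K: "T \<subseteq> K" and zero_notin_T: "0 \<notin> T"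
  by (auto simp: T_def)

text \<open>By \<open>E_transpose\<close>, the defining equation multiplies the coefficient at
  \<open>x\<close> by \<open>1 + chi x x\<close>, which vanishes exactly when \<open>x\<close> lies
  in \<open>T\<close>.\<close>

lemma L_eq_symplectic: "L = symplectic_lie_algebra S"
proof -
  obtain S' where S': "S ** S' = mat 1" using inv_S unfolding invertible_def by blast
  have "A \<in> symplectic_lie_algebra S \<longleftrightarrow> A \<in> L" for A
  proof -
    define B where "B = (\<Sum>x\<in>K. cmat_scale (coef x A * (1 + chi x x)) (E x))"
    have "A ** S + S ** transpose A =
      (\<Sum>x\<in>K. cmat_scale (coef x A) (E x)) ** S + S ** transpose (\<Sum>x\<in>K. cmat_scale (coef x A) (E x))"
      by (rule arg_cong[where f = "\<lambda>A. A ** S + S ** transpose A", OF expansion])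
    also have "\<dots> = (\<Sum>x\<in>K. cmat_scale (coef x A) (E x ** S) + cmat_scale (coef x A) (S ** transpose (E x)))"
      by (simp add: matrix_mult_sum transpose_sum transpose_cmat_scale cmat_scale_mult sum.distrib)
    also have "\<dots> = (\<Sum>x\<in>K. cmat_scale (coef x A * (1 + chi x x)) (E x ** S))"
      by (intro sum.cong) (simp_all add: E_transpose distrib_left cmat.scale_left_distrib)
    also have "\<dots> = B ** S" by (simp add: B_def matrix_mult_sum cmat_scale_mult)
    finally have "A ** S + S ** transpose A = B ** S" .
    moreover have "B ** S = 0 \<longleftrightarrow> B = 0"
    proof
      assume "B ** S = 0"
      then have "(B ** S) ** S' = 0" by simp
      then show "B = 0" by (simp add: S' flip: matrix_mul_assoc)
    qed simp
    moreover have "B = 0 \<longleftrightarrow> (\<forall>x\<in>K. coef x A * (1 + chi x x) = 0)"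
      unfolding eq_iff_coef[of B 0] by (simp add: B_def coef_sum_E)
    moreover have "1 + chi x x = 0 \<longleftrightarrow> x \<in> T" if "x \<in> K" for x
      using that chi_cases[of x x] by (auto simp: T_def)
    ultimately show ?thesis
      by (auto simp: symplectic_lie_algebra_def L_def supp_space_def)
  qed
  then show ?thesis by blast
qed

lemma WT_subset_K: "W i \<inter> T \<subseteq> K"
  using T_subset_K by blast

lemma Hs_subset_L: "Hs i \<subseteq> L"
  unfolding Hs_def L_def by (rule supp_space_mono) blast

text \<open>The lines cover \<open>K\<close> and meet only in zero. As zero is not in
  \<open>T\<close>, they partition \<open>T\<close>, and the basis of \<open>L\<close> splits
  accordingly.\<close>

lemma direct_sum: "direct_sum_decomp {1..q+1} Hs L"
  unfolding direct_sum_decomp_def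
proof (intro conjI ballI allI impI)
  show "cmat.subspace (Hs i)" for i by (simp add: Hs_def subspace_supp_space)
  show "L = {\<Sum>i\<in>{1..q+1}. h i | h. \<forall>i\<in>{1..q+1}. h i \<in> Hs i}" (is "_ = ?R")
  proof
    show "?R \<subseteq> L"
    proof
      fix A assume "A \<in> ?R"
      then obtain h where h: "A = (\<Sum>i\<in>{1..q+1}. h i)" "\<forall>i\<in>{1..q+1}. h i \<in> Hs i" by blast
      show "A \<in> L" unfolding h(1) L_def
      proof (rule cmat.subspace_sum[OF subspace_supp_space])
        show "h i \<in> supp_space T" if "i \<in> {1..q+1}" for i
          using Hs_subset_L[of i] h(2) that unfolding L_def by blast
      qed
    qed
    show "L \<subseteq> ?R"
    proof
      fix A assume A: "A \<in> L"
      define h where "h i = (\<Sum>x\<in>W i \<inter> T. cmat_scale (coef x A) (E x))" for i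
      have cover: "(\<Union>i\<in>{1..q+1}. W i \<inter> T) = T"
        using W_cover subsetD[OF T_subset_K] by blast
      have "(\<Sum>x\<in>(\<Union>i\<in>{1..q+1}. W i \<inter> T). cmat_scale (coef x A) (E x)) = (\<Sum>i\<in>{1..q+1}. h i)"
        unfolding h_def
      proof (rule sum.UNION_disjoint)
        show "\<forall>i\<in>{1..q+1}. \<forall>j\<in>{1..q+1}. i \<noteq> j \<longrightarrow> (W i \<inter> T) \<inter> (W j \<inter> T) = {}"
          using W_disjoint zero_notin_T by blast
      qed (simp_all add: finite_subset[OF WT_subset_K finite_K])
      then have "(\<Sum>x\<in>T. cmat_scale (coef x A) (E x)) = (\<Sum>i\<in>{1..q+1}. h i)"
        unfolding cover .
      then have "A = (\<Sum>i\<in>{1..q+1}. h i)"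
        by (rule trans[OF supp_expansion[OF T_subset_K A[unfolded L_def]]])
      moreover have "h i \<in> Hs i" for i
        unfolding h_def Hs_def by (rule sum_in_supp_space[OF WT_subset_K])
      ultimately show "A \<in> ?R" by blast
    qed
  qed
next
  fix h i assume h: "(\<forall>i\<in>{1..q+1}. h i \<in> Hs i) \<and> (\<Sum>i\<in>{1..q+1}. h i) = 0" and i: "i \<in> {1..q+1}"
  have "coef x (h i) = 0" if "x \<in> K" for x
  proof (cases "x \<in> W i \<inter> T")
    case True
    have "coef x (h j) = 0" if j: "j \<in> {1..q+1} - {i}" for j
    proof -
      have "x \<noteq> 0" using True zero_notin_T by blast
      then have "x \<notin> W j" using W_disjoint[of x i j] True i j by blast
      moreover have "h j \<in> Hs j" using h j by blast
      ultimately show ?thesis using \<open>x \<in> K\<close> unfolding Hs_def supp_space_def by blast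
    qed
    then have "coef x (h i) = (\<Sum>j\<in>{1..q+1}. coef x (h j))"
      using i by (subst sum.remove[of _ i]) auto
    also have "\<dots> = 0" using h by (simp flip: coef_sum)
    finally show ?thesis .
  next
    case False
    moreover have "h i \<in> Hs i" using h i by blast
    ultimately show ?thesis using that unfolding Hs_def supp_space_def by blast
  qed
  then show "h i = 0" by (simp add: eq_iff_coef[of _ 0])
qed

section \<open>Brackets, Cartan subalgebras and the Killing form\<close>

lemma lie_bracket_E:
  "x \<in> K \<Longrightarrow> y \<in> K \<Longrightarrow> lie_bracket (E x) (E y) = cmat_scale (chi x y - chi y x) (E (x + y))"
  by (simp add: lie_bracket_def E_mult cmat.scale_left_diff_distrib add.commute)

lemma lie_bracket_expansion:
  assumes "D \<subseteq> K" "D' \<subseteq> K" "A \<in> supp_space D" "B \<in> supp_space D'"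
  shows "lie_bracket A B = (\<Sum>x\<in>D. \<Sum>y\<in>D'.
    cmat_scale (coef x A * coef y B * (chi x y - chi y x)) (E (x + y)))"
proof -
  have "lie_bracket A B = lie_bracket (\<Sum>x\<in>D. cmat_scale (coef x A) (E x)) (\<Sum>y\<in>D'. cmat_scale (coef y B) (E y))"
    by (rule arg_cong2[where f = lie_bracket, OF supp_expansion[OF assms(1,3)] supp_expansion[OF assms(2,4)]])
  also have "\<dots> = (\<Sum>x\<in>D. \<Sum>y\<in>D'. cmat_scale (coef x A) (cmat_scale (coef y B) (lie_bracket (E x) (E y))))"
    by (simp only: lie_bracket_sum lie_bracket_scale cmat.scale_sum_right sum.swap[of _ D' D])
       (simp add: mult.commute)
  also have "\<dots> = (\<Sum>x\<in>D. \<Sum>y\<in>D'. cmat_scale (coef x A * coef y B * (chi x y - chi y x)) (E (x + y)))"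
    using assms by (intro sum.cong) (auto simp: lie_bracket_E subset_iff mult.assoc)
  finally show ?thesis .
qed

lemma Hs_abelian:
  assumes "A \<in> Hs i" "B \<in> Hs i"
  shows "lie_bracket A B = 0"
proof -
  have "chi x y - chi y x = 0" if "x \<in> W i \<inter> T" "y \<in> W i \<inter> T" for x y
    using that chi_commute_W[of x i y] by simp
  then show ?thesis
    using assms unfolding Hs_def
    by (subst lie_bracket_expansion[OF WT_subset_K WT_subset_K]) (auto intro!: sum.neutral)
qed

text \<open>For \<open>x\<close> in \<open>T\<close> off the line, some \<open>h\<close> in
  \<open>W i \<inter> T\<close> does not commute with it, and \<open>x + h\<close> is again off the
  line. The coefficient of the bracket with \<open>E h\<close> at \<open>x + h\<close> is a nonzero
  multiple of \<open>coef x A\<close> and has to vanish.\<close>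

lemma Hs_normalizer: "lie_normalizer L (Hs i) = Hs i"
proof
  have "0 \<in> Hs i" by (simp add: Hs_def supp_space_def)
  then show "Hs i \<subseteq> lie_normalizer L (Hs i)"
    using Hs_subset_L by (auto simp: lie_normalizer_def Hs_abelian)
  show "lie_normalizer L (Hs i) \<subseteq> Hs i"
  proof
    fix A assume A: "A \<in> lie_normalizer L (Hs i)"
    have "coef x A = 0" if x: "x \<in> K" "x \<notin> W i \<inter> T" for x
    proof (cases "x \<in> T")
      case False
      then show ?thesis using A x by (auto simp: lie_normalizer_def L_def supp_space_def)
    next
      case True
      then obtain h where h: "h \<in> W i" "h \<in> T" "chi x h \<noteq> chi h x"
        using W_Int_T_maximal[OF x(1)] x(2) by blast
      have hK: "h \<in> K" "x + h \<in> K" using h T_subset_K K_closed x by auto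
      have "x = x + h + h" by (simp add: add.assoc)
      then have "x + h \<notin> W i" using W_add[OF _ h(1), of "x + h"] x True by auto
      moreover have "lie_bracket A (E h) \<in> Hs i"
        using A E_in_supp_space[of h "W i \<inter> T"] h WT_subset_K
        by (auto simp: lie_normalizer_def Hs_def)
      ultimately have "0 = coef (x + h) (lie_bracket A (E h))"
        using hK by (simp add: Hs_def supp_space_def)
      also have "lie_bracket A (E h) = (\<Sum>z\<in>K. cmat_scale (coef z A * (chi z h - chi h z)) (E (z + h)))"
        using lie_bracket_expansion[of K "{h}" A "E h"] hK E_in_supp_space[of h "{h}"]
        by (simp add: supp_space_def coef_E)
      also have "coef (x + h) \<dots> = (\<Sum>z\<in>K. if z = x then coef z A * (chi z h - chi h z) else 0)"
        unfolding coef_sum coef_scale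
        using hK by (intro sum.cong) (auto simp: coef_E K_closed)
      also have "\<dots> = coef x A * (chi x h - chi h x)" using finite_K x by simp
      finally show ?thesis using h by simp
    qed
    then show "A \<in> Hs i" by (simp add: Hs_def supp_space_def)
  qed
qed

text \<open>Being abelian, \<open>Hs i\<close> has a lower central series that reaches zero at its
  first step; self-normalization is \<open>Hs_normalizer\<close>.\<close>

lemma Hs_cartan: "cartan_subalgebra L (Hs i)"
proof -
  have 0: "0 \<in> Hs i" by (simp add: Hs_def supp_space_def)
  have "{lie_bracket x y | x y. x \<in> Hs i \<and> y \<in> Hs i} = {0}"
  proof -
    have "\<exists>x y. 0 = lie_bracket x y \<and> x \<in> Hs i \<and> y \<in> Hs i"
      using 0 Hs_abelian[OF 0 0, symmetric] by blast
    then show ?thesis using Hs_abelian by blast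
  qed
  then have "lower_central (Hs i) (Suc 0) = {0}"
    by simp
  then have "lie_nilpotent (Hs i)" unfolding lie_nilpotent_def by blast
  moreover have "lie_subalgebra L (Hs i)"
    using Hs_subset_L subspace_supp_space 0 by (auto simp: lie_subalgebra_def Hs_abelian) (simp add: Hs_def)
  ultimately show ?thesis by (simp add: cartan_subalgebra_def Hs_normalizer)
qed

lemma lie_subalgebra_L: "lie_subalgebra L L"
  unfolding L_eq_symplectic by (rule lie_subalgebra_symplectic)

lemma L_lie_bracket: "A \<in> L \<Longrightarrow> B \<in> L \<Longrightarrow> lie_bracket A B \<in> L"
  using lie_subalgebra_L by (simp add: lie_subalgebra_def)

lemma representation_E:
  assumes "D \<subseteq> K" "x \<in> D" "A \<in> supp_space D"
  shows "cmat.representation (E ` D) A (E x) = coef x A"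
proof -
  have fin: "finite D" using assms finite_K finite_subset by blast
  have "A = (\<Sum>B\<in>E ` D. cmat_scale (cmat.representation (E ` D) A B) B)"
    using cmat.sum_representation_eq[of "E ` D" A "E ` D"] independent_E span_E_eq_supp_space assms fin
    by simp
  also have "\<dots> = (\<Sum>y\<in>D. cmat_scale (cmat.representation (E ` D) A (E y)) (E y))"
    using sum.reindex[OF inj_on_subset[OF inj_on_E assms(1)]] by (simp add: o_def)
  finally have "coef x A = coef x (\<Sum>y\<in>D. cmat_scale (cmat.representation (E ` D) A (E y)) (E y))"
    by (rule arg_cong)
  also have "\<dots> = cmat.representation (E ` D) A (E x)"
    using assms by (subst coef_sum_E) auto
  finally show ?thesis ..
qed

text \<open>Bracketing \<open>E z\<close> with \<open>E y\<close> and then \<open>E x\<close> lands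
  in degree \<open>x + y + z\<close>. On different lines \<open>x\<close> and \<open>y\<close> are
  distinct elements of \<open>T\<close>, so the degree changes and every diagonal entry of the
  composite is zero.\<close>

lemma Hs_orthogonal:
  assumes "i \<in> {1..q+1}" "j \<in> {1..q+1}" "i \<noteq> j"
  shows "killing_orthogonal L (Hs i) (Hs j)"
  unfolding killing_orthogonal_def
proof (intro ballI)
  fix A B assume AB: "A \<in> Hs i" "B \<in> Hs j"
  then have L: "A \<in> L" "B \<in> L" using Hs_subset_L by auto
  have "killing_form L A B = (\<Sum>b\<in>E ` T. cmat.representation (E ` T) (lie_bracket A (lie_bracket B b)) b)"
    unfolding killing_form_def
    using independent_E[OF T_subset_K] span_E_eq_supp_space[OF T_subset_K] L
    by (intro trace_on_eq) (auto simp: L_lie_bracket lie_bracket_add lie_bracket_scale simp flip: L_def)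
  also have "\<dots> = 0"
  proof (rule sum.neutral, rule ballI)
    fix b assume "b \<in> E ` T"
    then obtain z where z: "z \<in> T" "b = E z" by blast
    have zK: "z \<in> K" using z T_subset_K by auto
    have bL: "b \<in> L" unfolding L_def z(2) using z(1) T_subset_K by (rule E_in_supp_space)
    have AB_sum: "A = (\<Sum>x\<in>W i \<inter> T. cmat_scale (coef x A) (E x))"
      "B = (\<Sum>y\<in>W j \<inter> T. cmat_scale (coef y B) (E y))"
      by (rule supp_expansion[OF WT_subset_K], use AB in \<open>simp add: Hs_def\<close>)+
    have "lie_bracket A (lie_bracket B b) =
      lie_bracket (\<Sum>x\<in>W i \<inter> T. cmat_scale (coef x A) (E x))
       (lie_bracket (\<Sum>y\<in>W j \<inter> T. cmat_scale (coef y B) (E y)) (E z))"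
      unfolding z(2) by (intro arg_cong2[where f = lie_bracket] AB_sum refl)
    then have "coef z (lie_bracket A (lie_bracket B b)) =
      (\<Sum>y\<in>W j \<inter> T. \<Sum>x\<in>W i \<inter> T. coef y B * (coef x A * coef z (lie_bracket (E x) (lie_bracket (E y) (E z)))))"
      by (simp only: lie_bracket_sum lie_bracket_scale coef_sum coef_scale sum_distrib_left)
    also have "\<dots> = 0"
    proof (intro sum.neutral ballI)
      fix x y assume xy: "x \<in> W i \<inter> T" "y \<in> W j \<inter> T"
      then have K: "x \<in> K" "y \<in> K" using T_subset_K by auto
      have "x \<noteq> y" using xy assms W_disjoint[of x i j] zero_notin_T by auto
      then have "z \<noteq> x + (y + z)"
        using add_eq_0_iff_eq[of x y] by (metis add.assoc add_cancel_left_left)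
      then show "coef y B * (coef x A * coef z (lie_bracket (E x) (lie_bracket (E y) (E z)))) = 0"
        using K zK by (simp add: lie_bracket_E lie_bracket_scale coef_scale coef_E K_closed)
    qed
    finally have "coef z (lie_bracket A (lie_bracket B b)) = 0" .
    then show "cmat.representation (E ` T) (lie_bracket A (lie_bracket B b)) b = 0"
      using representation_E[OF T_subset_K z(1), of "lie_bracket A (lie_bracket B b)"]
        L_lie_bracket L bL z(2) by (simp add: L_def)
  qed
  finally show "killing_form L A B = 0" .
qed

end

section \<open>The cyclic automorphism\<close>

context twisted_basis
begin

definition rot :: "complex^'n^'n \<Rightarrow> complex^'n^'n" where
  "rot A = (\<Sum>x\<in>K. cmat_scale (coef x A) (E (om * x)))"

lemma om_mult_K: "x \<in> K \<Longrightarrow> om * x \<in> K"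
  by (rule K_closed(4)[OF om_in_K])

lemma om_power_mult_K: "x \<in> K \<Longrightarrow> om ^ k * x \<in> K"
  by (intro K_closed om_in_K)

lemma rot_add: "rot (A + B) = rot A + rot B"
  by (simp add: rot_def coef_add cmat.scale_left_distrib sum.distrib)

lemma rot_scale: "rot (cmat_scale c A) = cmat_scale c (rot A)"
  by (simp add: rot_def coef_scale cmat.scale_sum_right)

lemma coef_rot:
  assumes "x \<in> K"
  shows "coef (om * x) (rot A) = coef x A"
proof -
  have "coef (om * x) (rot A) = (\<Sum>y\<in>K. if y = x then coef x A else 0)"
    unfolding rot_def coef_sum coef_scale
    using assms om_mult_K by (intro sum.cong) (auto simp: coef_E)
  then show ?thesis using assms finite_K by simp
qed

lemma K_eq_om_mult: "x \<in> K \<Longrightarrow> \<exists>y\<in>K. x = om * y"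
  by (rule bexI[of _ "x / om"]) (simp_all add: K_closed(7) om_in_K)

lemma rot_sum: "rot (\<Sum>i\<in>I. A i) = (\<Sum>i\<in>I. rot (A i))"
proof -
  have "rot 0 = 0" using rot_scale[of 0 0] by simp
  then show ?thesis
    by (induction I rule: infinite_finite_induct) (simp_all add: rot_add)
qed

lemma rot_E:
  assumes "x \<in> K"
  shows "rot (E x) = E (om * x)"
proof -
  have "rot (E x) = (\<Sum>y\<in>K. if y = x then E (om * x) else 0)"
    unfolding rot_def using assms by (intro sum.cong) (auto simp: coef_E)
  then show ?thesis using assms finite_K by simp
qed

text \<open>On basis elements this is the invariance \<open>chi_om\<close>; expanding both arguments
  gives the general case.\<close>

lemma rot_lie_bracket: "rot (lie_bracket A B) = lie_bracket (rot A) (rot B)"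
proof -
  have bracket_E: "rot (lie_bracket (E x) (E y)) = lie_bracket (E (om * x)) (E (om * y))"
    if "x \<in> K" "y \<in> K" for x y
    using that by (simp add: lie_bracket_E rot_scale rot_E om_mult_K K_closed(3) chi_om distrib_left)
  have "lie_bracket A B = lie_bracket (\<Sum>x\<in>K. cmat_scale (coef x A) (E x)) (\<Sum>y\<in>K. cmat_scale (coef y B) (E y))"
    by (rule arg_cong2[where f = lie_bracket, OF expansion expansion])
  then have "rot (lie_bracket A B) =
    rot (lie_bracket (\<Sum>x\<in>K. cmat_scale (coef x A) (E x)) (\<Sum>y\<in>K. cmat_scale (coef y B) (E y)))"
    by (rule arg_cong)
  also have "\<dots> = (\<Sum>y\<in>K. \<Sum>x\<in>K. cmat_scale (coef y B) (cmat_scale (coef x A) (rot (lie_bracket (E x) (E y)))))"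
    by (simp only: lie_bracket_sum lie_bracket_scale rot_sum rot_scale cmat.scale_sum_right)
  also have "\<dots> = (\<Sum>y\<in>K. \<Sum>x\<in>K. cmat_scale (coef y B) (cmat_scale (coef x A) (lie_bracket (E (om * x)) (E (om * y)))))"
    by (intro sum.cong refl) (simp only: bracket_E)
  also have "\<dots> = lie_bracket (rot A) (rot B)"
    unfolding rot_def by (simp only: lie_bracket_sum lie_bracket_scale cmat.scale_sum_right)
  finally show ?thesis .
qed

lemma coef_rot_pow:
  assumes "x \<in> K"
  shows "coef (om ^ k * x) ((rot ^^ k) A) = coef x A"
proof (induction k)
  case (Suc k)
  then show ?case
    using coef_rot[OF om_power_mult_K[OF assms, of k], of "(rot ^^ k) A"] by (simp add: mult.assoc)
qed simp

lemma rot_pow_period: "(rot ^^ ((q + 1) * k)) A = A"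
proof -
  have "om ^ ((q + 1) * k) = 1" unfolding om_power_eq_1 q_def by (rule dvd_triv_left)
  then show ?thesis
    using coef_rot_pow[of _ "(q + 1) * k" A] unfolding eq_iff_coef by (metis mult_1)
qed

lemma rot_pow_mem_Hs_iff: "(rot ^^ k) A \<in> Hs (i + k) \<longleftrightarrow> A \<in> Hs i"
proof (induction k)
  case (Suc k)
  have "rot B \<in> Hs (Suc j) \<longleftrightarrow> B \<in> Hs j" for B j
  proof
    assume B: "rot B \<in> Hs (Suc j)"
    have "coef x B = 0" if "x \<in> K - W j \<inter> T" for x
    proof -
      have "om * x \<in> K - W (Suc j) \<inter> T" using that by (simp add: om_mult_W om_mult_T om_mult_K)
      then have "coef (om * x) (rot B) = 0" using B unfolding Hs_def supp_space_def by blast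
      then show ?thesis using coef_rot[of x B] that by simp
    qed
    then show "B \<in> Hs j" unfolding Hs_def supp_space_def by blast
  next
    assume B: "B \<in> Hs j"
    have "coef y (rot B) = 0" if y: "y \<in> K - W (Suc j) \<inter> T" for y
    proof -
      obtain x where x: "x \<in> K" "y = om * x" using K_eq_om_mult y by blast
      then have "x \<in> K - W j \<inter> T" using y by (simp add: om_mult_W om_mult_T)
      then have "coef x B = 0" using B unfolding Hs_def supp_space_def by blast
      then show ?thesis using coef_rot[OF x(1)] x(2) by simp
    qed
    then show "rot B \<in> Hs (Suc j)" unfolding Hs_def supp_space_def by blast
  qed
  then show ?case using Suc by simp
qed simp

lemma rot_pow_L: "A \<in> L \<Longrightarrow> (rot ^^ k) A \<in> L"
proof (induction k)
  case (Suc k)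
  have "coef y (rot B) = 0" if B: "B \<in> L" and y: "y \<in> K - T" for B y
  proof -
    obtain x where x: "x \<in> K" "y = om * x" using K_eq_om_mult y by blast
    then have "x \<in> K - T" using y by (simp add: om_mult_T)
    then have "coef x B = 0" using B unfolding L_def supp_space_def by blast
    then show ?thesis using coef_rot[OF x(1)] x(2) by simp
  qed
  then have "rot B \<in> L" if "B \<in> L" for B using that unfolding L_def supp_space_def by blast
  then show ?case using Suc by simp
qed simp

lemma Hs_periodic: "Hs (i + (q + 1) * k) = Hs i"
  using W_mod[of "i + (q + 1) * k"] W_mod[of i] by (simp add: Hs_def del: mult_Suc)

lemma rot_pow_image_Hs: "(rot ^^ k) ` Hs i = Hs (i + k)"
proof
  show "(rot ^^ k) ` Hs i \<subseteq> Hs (i + k)" using rot_pow_mem_Hs_iff by blast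
  show "Hs (i + k) \<subseteq> (rot ^^ k) ` Hs i"
  proof
    fix A assume A: "A \<in> Hs (i + k)"
    \<comment> \<open>The power \<open>q * k\<close> of \<open>rot\<close> inverts the power
      \<open>k\<close>, because \<open>k + q * k\<close> is a multiple of the period
      \<open>q + 1\<close>.\<close>
    have "(rot ^^ k) ((rot ^^ (q * k)) A) = (rot ^^ ((q + 1) * k)) A"
      by (simp add: funpow_add)
    then have k: "(rot ^^ k) ((rot ^^ (q * k)) A) = A" by (simp only: rot_pow_period)
    then have "(rot ^^ (q * k)) A \<in> Hs i" using rot_pow_mem_Hs_iff[of k "(rot ^^ (q * k)) A" i] A by simp
    then show "A \<in> (rot ^^ k) ` Hs i" using k by (metis imageI)
  qed
qed

text \<open>With all naturals as indices, the action on the subalgebras is plain addition of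
  exponents.\<close>

lemma Hs_range: "Hs ` {1..q + 1} = range Hs"
proof
  show "range Hs \<subseteq> Hs ` {1..q + 1}"
  proof
    fix H assume "H \<in> range Hs"
    then obtain i where i: "H = Hs i" by blast
    define j where "j = (if i mod (q + 1) = 0 then q + 1 else i mod (q + 1))"
    have "j \<in> {1..q + 1}" unfolding j_def by (auto simp: Suc_le_eq less_imp_le)
    moreover have "j mod (q + 1) = i mod (q + 1)" by (simp add: j_def)
    then have "W j = W i" using W_mod[of i] W_mod[of j] by simp
    then have "Hs j = Hs i" by (simp add: Hs_def)
    ultimately show "H \<in> Hs ` {1..q + 1}" unfolding i by (metis imageI)
  qed
qed blast

text \<open>The restriction matches the convention that members of \<open>LieAutoGroup L\<close> are
  \<open>undefined\<close> outside \<open>L\<close>.\<close>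

definition rot_auto :: "complex^'n^'n \<Rightarrow> complex^'n^'n" where
  "rot_auto = restrict rot L"

lemma rot_in_L: "A \<in> L \<Longrightarrow> rot A \<in> L"
  using rot_pow_L[of A 1] by simp

lemma L_closed: "A \<in> L \<Longrightarrow> B \<in> L \<Longrightarrow> A + B \<in> L" "A \<in> L \<Longrightarrow> cmat_scale c A \<in> L"
  using subspace_supp_space[of T] by (auto simp: L_def cmat.subspace_def)

lemma rot_auto_in_group: "rot_auto \<in> carrier (LieAutoGroup L)"
proof -
  have "bij_betw rot L L"
  proof (rule bij_betw_byWitness[where f' = "rot ^^ q"])
    have "(rot ^^ q) (rot A) = (rot ^^ ((q + 1) * 1)) A" "rot ((rot ^^ q) A) = (rot ^^ ((q + 1) * 1)) A" for A
      by (simp_all add: funpow_swap1)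
    then show "\<forall>A\<in>L. (rot ^^ q) (rot A) = A" "\<forall>A\<in>L. rot ((rot ^^ q) A) = A"
      by (simp_all only: rot_pow_period simp_thms ball_simps ball_triv)
  qed (auto intro: rot_in_L rot_pow_L)
  then have "rot_auto \<in> Bij L"
    by (simp add: Bij_def rot_auto_def bij_betw_cong[of L "restrict rot L" rot])
  then show ?thesis
    by (simp add: LieAutoGroup_def lie_auto_def rot_auto_def L_closed L_lie_bracket rot_add rot_scale rot_lie_bracket)
qed

lemma group_L: "group (LieAutoGroup L)"
  by (rule group_LieAutoGroup[OF lie_subalgebra_L])

lemma rot_auto_pow: "rot_auto [^]\<^bsub>LieAutoGroup L\<^esub> (k::nat) = restrict (rot ^^ k) L"
proof (induction k)
  case 0
  have "\<one>\<^bsub>LieAutoGroup L\<^esub> = restrict (rot ^^ 0) L"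
    by (simp add: LieAutoGroup_def BijGroup_def id_def)
  then show ?case unfolding nat_pow_0 .
next
  case (Suc k)
  have carrier: "f \<in> Bij L" if "f \<in> carrier (LieAutoGroup L)" for f
    using that by (simp add: LieAutoGroup_def lie_auto_def)
  have mult: "f \<otimes>\<^bsub>LieAutoGroup L\<^esub> g = compose L f g" if "f \<in> Bij L" "g \<in> Bij L" for f g
    using that by (simp add: LieAutoGroup_def BijGroup_def)
  have pow: "restrict (rot ^^ k) L \<in> carrier (LieAutoGroup L)"
    using monoid.nat_pow_closed[OF group.is_monoid[OF group_L] rot_auto_in_group, of k]
    unfolding Suc .
  have "compose L (restrict (rot ^^ k) L) rot_auto = restrict (rot ^^ Suc k) L"
    unfolding compose_def funpow_Suc_right by (rule restrict_ext) (simp add: rot_auto_def rot_in_L)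
  then show ?case
    unfolding nat_pow_Suc Suc mult[OF carrier[OF pow] carrier[OF rot_auto_in_group]] .
qed

text \<open>A single basis element with nonzero degree \<open>x\<close> in \<open>T\<close> detects
  the order: a power \<open>k\<close> that fixes \<open>E x\<close> satisfies
  \<open>om ^ k * x = x\<close>, so \<open>q + 1\<close> divides \<open>k\<close>.\<close>

lemma ord_rot_auto: "group.ord (LieAutoGroup L) rot_auto = q + 1"
proof -
  have "rot_auto [^]\<^bsub>LieAutoGroup L\<^esub> k = \<one>\<^bsub>LieAutoGroup L\<^esub> \<longleftrightarrow> q + 1 dvd k" for k :: nat
  proof
    assume "q + 1 dvd k"
    then obtain l where k: "k = (q + 1) * l" unfolding dvd_def by blast
    have "restrict (rot ^^ k) L = (\<lambda>A\<in>L. A)"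
      unfolding k by (rule restrict_ext) (rule rot_pow_period)
    then show "rot_auto [^]\<^bsub>LieAutoGroup L\<^esub> k = \<one>\<^bsub>LieAutoGroup L\<^esub>"
      unfolding rot_auto_pow by (simp add: LieAutoGroup_def BijGroup_def)
  next
    assume k: "rot_auto [^]\<^bsub>LieAutoGroup L\<^esub> k = \<one>\<^bsub>LieAutoGroup L\<^esub>"
    obtain x where x: "x \<in> T" using W_Int_T_nonempty by blast
    then have xK: "x \<in> K" and EL: "E x \<in> L"
      using T_subset_K by (auto simp: L_def intro: E_in_supp_space)
    have "restrict (rot ^^ k) L (E x) = (\<lambda>A\<in>L. A) (E x)"
      using k unfolding rot_auto_pow by (simp add: LieAutoGroup_def BijGroup_def)
    then have "(rot ^^ k) (E x) = E x" using EL by simp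
    then have "coef (om ^ k * x) (E x) = 1"
      using coef_rot_pow[OF xK, of k "E x"] coef_E[OF xK xK] by simp
    then have "om ^ k * x = x"
      using coef_E[OF om_power_mult_K[OF xK] xK, of k] by (auto split: if_splits)
    moreover have "x \<noteq> 0" using x zero_notin_T by auto
    ultimately have "om ^ k = 1" by simp
    then show "q + 1 dvd k" using om_power_eq_1 by (simp add: q_def)
  qed
  then have iff: "group.ord (LieAutoGroup L) rot_auto dvd k \<longleftrightarrow> q + 1 dvd k" for k
    unfolding group.pow_eq_id[OF group_L rot_auto_in_group] .
  show ?thesis
  proof (rule dvd_antisym)
    show "group.ord (LieAutoGroup L) rot_auto dvd q + 1" unfolding iff by (rule dvd_refl)
    show "q + 1 dvd group.ord (LieAutoGroup L) rot_auto" unfolding iff[symmetric] by (rule dvd_refl)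
  qed
qed

lemma generate_rot_auto:
  "generate (LieAutoGroup L) {rot_auto} = {restrict (rot ^^ k) L | k. True}"
  using group.generate_pow_nat[OF group_L rot_auto_in_group] ord_rot_auto
  by (simp add: rot_auto_pow)

lemma rot_auto_transitive:
  "permutes_transitively (generate (LieAutoGroup L) {rot_auto}) (Hs ` {1..q+1})"
proof -
  have img: "restrict (rot ^^ k) L ` Hs i = Hs (i + k)" for k i
  proof -
    have "restrict (rot ^^ k) L ` Hs i = (rot ^^ k) ` Hs i"
      by (rule image_cong) (use Hs_subset_L in auto)
    then show ?thesis by (simp only: rot_pow_image_Hs)
  qed
  have "bij_betw (image g) (range Hs) (range Hs)" if gen: "g \<in> generate (LieAutoGroup L) {rot_auto}" for g
  proof -
    obtain k where g: "g = restrict (rot ^^ k) L" using gen generate_rot_auto by auto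
    have "image g ` range Hs = range Hs"
    proof
      show "image g ` range Hs \<subseteq> range Hs" using img g by auto
      have "Hs i = g ` Hs (i + q * k)" for i
        unfolding g img using Hs_periodic[of i k] by (simp add: algebra_simps)
      then show "range Hs \<subseteq> image g ` range Hs" by blast
    qed
    \<comment> \<open>Injectivity follows from surjectivity on a finite set.\<close>
    moreover have "finite (range Hs)" using Hs_range by (metis finite_atLeastAtMost finite_imageI)
    ultimately show ?thesis
      by (metis bij_betw_def eq_card_imp_inj_on)
  qed
  moreover have "\<exists>g\<in>generate (LieAutoGroup L) {rot_auto}. g ` Hs i = Hs j" for i j
  \<comment> \<open>The shifted index is \<open>i + (j + q * i) = j + (q + 1) * i\<close>, congruent
    to \<open>j\<close> modulo the period.\<close>
  proof (rule bexI[of _ "restrict (rot ^^ (j + q * i)) L"])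
    show "restrict (rot ^^ (j + q * i)) L ` Hs i = Hs j"
      unfolding img using Hs_periodic[of j i] by (simp add: algebra_simps)
    show "restrict (rot ^^ (j + q * i)) L \<in> generate (LieAutoGroup L) {rot_auto}"
      using generate_rot_auto by blast
  qed
  ultimately show ?thesis unfolding permutes_transitively_def Hs_range by blast
qed

end

text \<open>The algebraic closure of the field with two elements serves as ambient field for every
  \<open>m\<close>.\<close>

lemma spread_field_exists:
  assumes "m > 0"
  obtains lam om :: "bit alg_closure" where "spread_field m lam om"
proof -
  have char: "CHAR(bit alg_closure) = 2" by (simp add: CHAR_bit)
  obtain lam :: "bit alg_closure" where lam: "lam ^ (2 ^ m) = lam + 1"
    using exists_trace_one[OF assms] .
  obtain om :: "bit alg_closure" where "\<And>j. om ^ j = 1 \<longleftrightarrow> (2 ^ m + 1) dvd j"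
    "\<And>x. x ^ (2 ^ m + 1) = 1 \<Longrightarrow> \<exists>j. x = om ^ j"
    using exists_primitive_unit_root[OF char assms] by blast
  then have "spread_field m lam om" using char assms lam by unfold_locales auto
  then show ?thesis by (rule that)
qed

theorem theorem4:
  fixes S :: "complex^'n^'n" and L :: "(complex^'n^'n) set" and m q :: nat
  assumes "m \<ge> 1" and "q = 2 ^ m" and "CARD('n) = q"
    and "invertible S" and "transpose S = - S"
    and "L = symplectic_lie_algebra S"
  shows "\<exists>(H :: nat \<Rightarrow> (complex^'n^'n) set) \<phi>.
    direct_sum_decomp {1..q+1} H L \<and>
    (\<forall>i\<in>{1..q+1}. cartan_subalgebra L (H i)) \<and>
    (\<forall>i\<in>{1..q+1}. \<forall>j\<in>{1..q+1}. i \<noteq> j \<longrightarrow> killing_orthogonal L (H i) (H j)) \<and>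
    \<phi> \<in> carrier (LieAutoGroup L) \<and>
    group.ord (LieAutoGroup L) \<phi> = q + 1 \<and>
    permutes_transitively (generate (LieAutoGroup L) {\<phi>}) (H ` {1..q+1})"
proof -
  have m: "m > 0" using assms(1) by simp
  obtain lam om :: "bit alg_closure" where "spread_field m lam om"
    using spread_field_exists[OF m] .
  then interpret F: spread_field m lam om .
  have q: "F.q = q" by (simp add: F.q_def assms(2))
  obtain E0 :: "bit alg_closure \<Rightarrow> complex^'n^'n" and S0 where E0: "E0 0 = mat 1"
    "\<And>x y. x \<in> F.K \<Longrightarrow> y \<in> F.K \<Longrightarrow> E0 x ** E0 y = cmat_scale (F.chi x y) (E0 (x + y))"
    "\<And>x. x \<in> F.K \<Longrightarrow> S0 ** transpose (E0 x) = cmat_scale (F.chi x x) (E0 x ** S0)"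
    and S0: "transpose S0 = - S0" "invertible S0"
    using F.exists_twisted_group_basis[where 'n = 'n] assms(3) q by metis
  have "even CARD('n)" using m assms(2,3) by simp
  then obtain P where P: "invertible P" "P ** S0 ** transpose P = S"
    using skew_matrices_congruent[OF _ S0(2,1) assms(4,5)] by blast
  obtain P' where P': "P ** P' = mat 1" "P' ** P = mat 1" using P(1) unfolding invertible_def by blast
  \<comment> \<open>Conjugation by \<open>P\<close> preserves the multiplication rule, and
    \<open>S = P ** S0 ** transpose P\<close> turns the transpose rule for \<open>S0\<close> into
    the one for \<open>S\<close>.\<close>
  define E where "E x = P ** E0 x ** P'" for x
  have cancel: "A ** P' ** P = A" for A :: "complex^'n^'n"
    by (simp add: P' flip: matrix_mul_assoc)
  interpret twisted_basis m lam om E S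
  proof
    show "CARD('n) = F.q" using assms(3) q by simp
    show "E 0 = mat 1" by (simp add: E_def E0 P')
    show "E x ** E y = cmat_scale (F.chi x y) (E (x + y))" if "x \<in> F.K" "y \<in> F.K" for x y
    proof -
      have "E x ** E y = P ** (E0 x ** E0 y) ** P'"
        by (simp add: E_def matrix_mul_assoc cancel)
      then show ?thesis by (simp add: E0 that cmat_scale_mult E_def)
    qed
    show "S ** transpose (E x) = cmat_scale (F.chi x x) (E x ** S)" if "x \<in> F.K" for x
    proof -
      have "transpose P ** transpose P' = mat 1" by (metis P'(2) matrix_transpose_mul transpose_mat)
      then have cancel_t: "A ** transpose P ** transpose P' = A" for A :: "complex^'n^'n"
        by (simp flip: matrix_mul_assoc)
      have "S ** transpose (E x) = P ** (S0 ** transpose (E0 x)) ** transpose P"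
        by (simp add: E_def matrix_transpose_mul matrix_mul_assoc cancel_t flip: P(2))
      also have "\<dots> = cmat_scale (F.chi x x) (P ** E0 x ** S0 ** transpose P)"
        by (simp add: E0 that cmat_scale_mult matrix_mul_assoc)
      also have "P ** E0 x ** S0 ** transpose P = E x ** S"
        by (simp add: E_def matrix_mul_assoc cancel flip: P(2))
      finally show ?thesis .
    qed
    show "invertible S" by fact
  qed
  show ?thesis
    unfolding assms(6) q[symmetric] L_eq_symplectic[symmetric]
    using direct_sum Hs_cartan Hs_orthogonal rot_auto_in_group ord_rot_auto rot_auto_transitive
    by blast
qed

end
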